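(* Let $q$ be a prime power and let $M$ be a simple $\mathrm{GF}(q)$-representable matroid. The catenary data of a $q$-cone $M'$ of $M$ can be calculated from the catenary data of $M$. Thus, the $\mathcal{G}$-invariant of a $q$-cone $M'$ of $M$ depends only on $\mathcal{G}(M)$ (and $q$), not on $M$ or on the representation. That is: if $M$ and $N$ are simple $\mathrm{GF}(q)$-representable matroids with the same catenary data (equivalently, with $\mathcal{G}(M)=\mathcal{G}(N)$), $M'$ is any $q$-cone of $M$, and $N'$ is any $q$-cone of $N$, then $M'$ and $N'$ have the same catenary data and $\mathcal{G}(M')=\mathcal{G}(N')$.
   Context: $q$-cones: let $M$ be a simple $\mathrm{GF}(q)$-representable rank-$r$ matroid. Choose a representation of $M$ in the rank-$(r+1)$ projective geometry $\mathrm{PG}(r,q)$, i.e., a set $E$ of points of $\mathrm{PG}(r,q)$ such that the restriction $\mathrm{PG}(r,q)|E$ is isomorphic to $M$. Let $A\mapsto\overline{A}$ be the closure operator of $\mathrm{PG}(r,q)$. Choose a point $a$ of $\mathrm{PG}(r,q)$ not in the hyperplane $\overline{E}$, and let $E'=\bigcup_{p\in E}\overline{\{a,p\}}$. The matroid $\mathrm{PG}(r,q)|E'$ is the $q$-cone of $M$ with base $E$ and apex $a$. (Different choices of $E$ may yield non-isomorphic $q$-cones.) Catenary data: for a rank-$r$ matroid $M$ on an $n$-element set $E$, an $(n,r)$-composition is an integer sequence $(a_0,\ldots,a_r)$ with $a_0\ge0$, $a_j>0$ for $1\le j\le r$, and sum $n$. A flag is a chain $X_0\subset X_1\subset\cdots\subset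 X_r=E$ of flats with $r(X_j)=j$; its composition is $(|X_0|,|X_1-X_0|,\ldots,|X_r-X_{r-1}|)$. $\nu(M;a_0,\ldots,a_r)$ is the number of flags with composition $(a_0,\ldots,a_r)$; the catenary data of $M$ is the vector of these numbers indexed by $(n,r)$-compositions. $\mathcal{G}$-invariant: $\mathcal{G}(n,r)$ is the vector space over a field of characteristic zero with basis the formal symbols $[\underline{r}]$, one for each $0,1$-sequence of length $n$ with exactly $r$ ones. For a permutation (linear ordering) $\pi$ of $E$, the rank sequence $\underline{r}(\pi)=r_1\ldots r_n$ has $r_j=r(\{\pi(1),\ldots,\pi(j)\})-r(\{\pi(1),\ldots,\pi(j-1)\})$. Then $\mathcal{G}(M)=\sum_\pi[\underline{r}(\pi)]\in\mathcal{G}(n,r)$ over all $n!$ permutations of $E$. Two matroids have the same $\mathcal{G}$-invariant if and only if they have the same catenary data. *)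

theory Defs
  imports
    Complex_Main
    "HOL-Library.Cardinality"
    "HOL-Library.Function_Algebras"
    "HOL-Library.Poly_Mapping"
    "HOL-Combinatorics.Multiset_Permutations"
    "HOL-Number_Theory.Prime_Powers"
begin

section \<open>Matroids\<close>

record 'a set_system =
  ground :: "'a set"
  indep :: "'a set \<Rightarrow> bool"

locale matroid =
  fixes M :: "'a set_system"
  assumes finite_ground: "finite (ground M)"
    and indep_subset_ground: "indep M X \<Longrightarrow> X \<subseteq> ground M"
    and indep_empty: "indep M {}"
    and indep_subset: "indep M X \<Longrightarrow> Y \<subseteq> X \<Longrightarrow> indep M Y"
    and augment: "indep M X \<Longrightarrow> indep M Y \<Longrightarrow> card X < card Y \<Longrightarrow>
      \<exists>y \<in> Y - X. indep M (insert y X)"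

definition rk :: "'a set_system \<Rightarrow> 'a set \<Rightarrow> nat" where
  "rk M X = Max {card I | I. I \<subseteq> X \<and> indep M I}"

definition cl :: "'a set_system \<Rightarrow> 'a set \<Rightarrow> 'a set" where
  "cl M X = {x \<in> ground M. rk M (insert x X) = rk M X}"

definition is_flat :: "'a set_system \<Rightarrow> 'a set \<Rightarrow> bool" where
  "is_flat M X \<longleftrightarrow> X \<subseteq> ground M \<and> cl M X = X"

definition simple_matroid :: "'a set_system \<Rightarrow> bool" where
  "simple_matroid M \<longleftrightarrow> matroid M \<and>
     (\<forall>x \<in> ground M. indep M {x}) \<and>
     (\<forall>x \<in> ground M. \<forall>y \<in> ground M. x \<noteq> y \<longrightarrow> indep M {x, y})"

definition restriction :: "'a set_system \<Rightarrow> 'a set \<Rightarrow> 'a set_system" where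
  "restriction M X = \<lparr>ground = ground M \<inter> X, indep = (\<lambda>I. I \<subseteq> X \<and> indep M I)\<rparr>"

definition isomorphic :: "'a set_system \<Rightarrow> 'b set_system \<Rightarrow> bool" where
  "isomorphic M N \<longleftrightarrow> (\<exists>f. bij_betw f (ground M) (ground N) \<and>
     (\<forall>X \<subseteq> ground M. indep M X \<longleftrightarrow> indep N (f ` X)))"


section \<open>Catenary data\<close>

definition compositions :: "nat \<Rightarrow> nat \<Rightarrow> nat list set" where
  "compositions n r =
     {a. length a = Suc r \<and> (\<forall>j \<in> {1..r}. a ! j > 0) \<and> sum_list a = n}"

definition flags :: "'a set_system \<Rightarrow> 'a set list set" where
  "flags M = (let r = rk M (ground M) in
     {X. length X = Suc r \<and>
         (\<forall>j \<le> r. is_flat M (X ! j) \<and> rk M (X ! j) = j) \<and>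
         (\<forall>j < r. X ! j \<subset> X ! Suc j) \<and>
         X ! r = ground M})"

definition flag_composition :: "'a set list \<Rightarrow> nat list" where
  "flag_composition X =
     card (X ! 0) # map (\<lambda>j. card (X ! Suc j - X ! j)) [0..<length X - 1]"

definition nu :: "'a set_system \<Rightarrow> nat list \<Rightarrow> nat" where
  "nu M a = card {X \<in> flags M. flag_composition X = a}"

text \<open>The catenary data is a vector indexed by the \<open>(n, r)\<close>-compositions. It is rendered as
  a partial map with exactly that domain, so that equality of catenary data includes equality of
  the index sets (hence of \<open>n\<close> and \<open>r\<close>).\<close>

definition catenary_data :: "'a set_system \<Rightarrow> nat list \<rightharpoonup> nat" where
  "catenary_data M =
     (\<lambda>a. if a \<in> compositions (card (ground M)) (rk M (ground M)) then Some (nu M a) else None)"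


section \<open>The \<open>\<G>\<close>-invariant\<close>

definition rank_sequence :: "'a set_system \<Rightarrow> 'a list \<Rightarrow> nat list" where
  "rank_sequence M \<pi> =
     map (\<lambda>j. rk M (set (take (Suc j) \<pi>)) - rk M (set (take j \<pi>))) [0..<length \<pi>]"

text \<open>The spaces \<open>\<G>(n, r)\<close> are realised inside one free vector space, with basis symbol
  \<open>[s]\<close> being \<open>Poly_Mapping.single s 1\<close> for a sequence \<open>s\<close>;
  \<open>\<G>(n, r)\<close> is spanned by the 0,1-sequences of length \<open>n\<close> with \<open>r\<close> ones.\<close>

definition G_invariant :: "'a set_system \<Rightarrow> nat list \<Rightarrow>\<^sub>0 'k::field_char_0" where
  "G_invariant M =
     (\<Sum>\<pi> \<in> permutations_of_set (ground M). Poly_Mapping.single (rank_sequence M \<pi>) 1)"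


section \<open>Projective geometries and representability\<close>

text \<open>The coordinate space of dimension \<open>n\<close> over a field is the space of sequences vanishing from
  index \<open>n\<close> on; this keeps the dimension a term rather than a type.\<close>

definition fscale :: "'f::field \<Rightarrow> (nat \<Rightarrow> 'f) \<Rightarrow> nat \<Rightarrow> 'f" where
  "fscale c v = (\<lambda>i. c * v i)"

global_interpretation fvec: vector_space "fscale :: 'f::field \<Rightarrow> (nat \<Rightarrow> 'f) \<Rightarrow> nat \<Rightarrow> 'f"
  by unfold_locales (auto simp: fscale_def fun_eq_iff algebra_simps)

definition coord_space :: "nat \<Rightarrow> (nat \<Rightarrow> 'f::field) set" where
  "coord_space n = {v. \<forall>i \<ge> n. v i = 0}"

type_synonym 'f point = "(nat \<Rightarrow> 'f) set"

definition PG_points :: "nat \<Rightarrow> 'f::field point set" where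
  "PG_points r = {p. fvec.subspace p \<and> p \<subseteq> coord_space (Suc r) \<and> fvec.dim p = 1}"

text \<open>\<open>PG r\<close> has rank \<open>r + 1\<close>; the rank of a set of points is the dimension of its span.\<close>

definition PG :: "nat \<Rightarrow> 'f::{field,finite} point set_system" where
  "PG r = \<lparr>ground = PG_points r,
     indep = (\<lambda>I. I \<subseteq> PG_points r \<and> fvec.dim (fvec.span (\<Union>I)) = card I)\<rparr>"

definition representable :: "'f::{field,finite} itself \<Rightarrow> 'a set_system \<Rightarrow> bool" where
  "representable _ M \<longleftrightarrow> (\<exists>n. \<exists>v :: 'a \<Rightarrow> nat \<Rightarrow> 'f.
     v ` ground M \<subseteq> coord_space n \<and>
     (\<forall>X \<subseteq> ground M. indep M X \<longleftrightarrow> inj_on v X \<and> \<not> fvec.dependent (v ` X)))"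

definition is_q_cone :: "'f::{field,finite} point set_system \<Rightarrow> 'a set_system \<Rightarrow> bool" where
  "is_q_cone M' M \<longleftrightarrow> (let P = PG (rk M (ground M)) in
     \<exists>E a. E \<subseteq> ground P \<and> isomorphic (restriction P E) M \<and>
           a \<in> ground P - cl P E \<and>
           M' = restriction P (\<Union>p \<in> E. cl P {a, p}))"

end

theory Submission
  imports Defs
begin

text \<open>
  Both the catenary data and the invariant \<open>\<G>(M)\<close> carry the same information as the multiset of
  compositions of the flags of \<open>M\<close>. Indeed, an ordering of the ground set determines the flag of
  closures of its initial segments, and the number of orderings with a given flag and a given rank
  sequence depends only on the composition of the flag. The resulting linear system is triangular:
  the rank sequence in which each flat of the flag is exhausted before the next one is entered
  occurs only for compositions with larger or equal partial sums.

  In a cone over \<open>E\<close> with apex \<open>a\<close>, the flats containing \<open>a\<close> are the cones over flats \<open>Y\<close> of \<open>E\<close>,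
  of size \<open>q |Y| + 1\<close>. A flat that avoids \<open>a\<close> is mapped isomorphically to a flat of \<open>E\<close> by the
  projection from \<open>a\<close>, and \<open>q ^ rk Y\<close> flats project onto \<open>Y\<close>. So each flag of \<open>E\<close> gives rise to
  the flags of the cone in which \<open>a\<close> enters after the flat of rank \<open>k\<close>, for each \<open>k\<close>, with
  \<open>q ^ k\<close> choices, and the compositions of these flags depend only on \<open>q\<close> and the composition of
  the given one.
\<close>

section \<open>Rank and closure\<close>

context matroid
begin

lemma finite_indep: "indep M I \<Longrightarrow> finite I"
  using finite_ground indep_subset_ground finite_subset by blast

lemma finite_rk_set: "finite {card I | I. I \<subseteq> X \<and> indep M I}"
proof -
  have "{card I | I. I \<subseteq> X \<and> indep M I} \<subseteq> card ` Pow (ground M)"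
    using indep_subset_ground by auto
  then show ?thesis
    using finite_ground finite_subset by blast
qed

lemma card_le_rk: "indep M I \<Longrightarrow> I \<subseteq> X \<Longrightarrow> card I \<le> rk M X"
  unfolding rk_def by (rule Max_ge[OF finite_rk_set]) auto

lemma obtain_basis:
  obtains I where "I \<subseteq> X" "indep M I" "card I = rk M X"
proof -
  have "rk M X \<in> {card I | I. I \<subseteq> X \<and> indep M I}"
    unfolding rk_def using indep_empty by (intro Max_in finite_rk_set) auto
  then show ?thesis using that by auto
qed

lemma rk_eqI:
  assumes "indep M I" "I \<subseteq> X" "\<And>J. indep M J \<Longrightarrow> J \<subseteq> X \<Longrightarrow> card J \<le> card I"
  shows "rk M X = card I"
proof (rule antisym)
  obtain J where "J \<subseteq> X" "indep M J" "card J = rk M X" by (rule obtain_basis)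
  then show "rk M X \<le> card I" using assms(3) by metis
qed (use assms card_le_rk in auto)

lemma rk_indep: "indep M I \<Longrightarrow> rk M I = card I"
  by (rule rk_eqI) (auto intro: card_mono finite_indep)

lemma rk_mono: "X \<subseteq> Y \<Longrightarrow> rk M X \<le> rk M Y"
proof -
  assume "X \<subseteq> Y"
  obtain I where "I \<subseteq> X" "indep M I" "card I = rk M X" by (rule obtain_basis)
  with \<open>X \<subseteq> Y\<close> show ?thesis using card_le_rk[of I Y] by auto
qed

lemma rk_empty [simp]: "rk M {} = 0"
  using rk_indep[OF indep_empty] by simp

lemma rk_le_card: "finite X \<Longrightarrow> rk M X \<le> card X"
  using obtain_basis[of X] card_mono[of X] by metis

lemma rk_insert_le: "rk M (insert x X) \<le> Suc (rk M X)"
proof -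
  obtain I where I: "I \<subseteq> insert x X" "indep M I" "card I = rk M (insert x X)"
    by (rule obtain_basis)
  have "card (I - {x}) \<le> rk M X"
    using I by (intro card_le_rk indep_subset[OF I(2)]) auto
  moreover have "card I \<le> Suc (card (I - {x}))"
    using card_Suc_Diff1[OF finite_indep[OF I(2)], of x] by (cases "x \<in> I") auto
  ultimately show ?thesis using I(3) by linarith
qed

lemma rk_insert_cases: "rk M (insert x X) = rk M X \<or> rk M (insert x X) = Suc (rk M X)"
  using rk_insert_le[of x X] rk_mono[OF subset_insertI, of X x] by linarith

lemma extend_to_basis:
  assumes "indep M I" "I \<subseteq> X"
  obtains J where "I \<subseteq> J" "J \<subseteq> X" "indep M J" "card J = rk M X"
proof -
  have "\<exists>J. I \<subseteq> J \<and> J \<subseteq> X \<and> indep M J \<and> card J = rk M X"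
    using assms
  proof (induction "rk M X - card I" arbitrary: I)
    case 0
    then show ?case using card_le_rk[of I X] by (intro exI[of _ I]) auto
  next
    case (Suc n)
    obtain B where B: "B \<subseteq> X" "indep M B" "card B = rk M X"
      by (rule obtain_basis)
    then obtain y where y: "y \<in> B - I" "indep M (insert y I)"
      using augment[OF Suc.prems(1) B(2)] Suc.hyps(2) by fastforce
    have "card (insert y I) = Suc (card I)"
      using y finite_indep[OF Suc.prems(1)] by simp
    then have "\<exists>J. insert y I \<subseteq> J \<and> J \<subseteq> X \<and> indep M J \<and> card J = rk M X"
      using Suc.hyps(2) Suc.prems y B by (intro Suc.hyps(1)) auto
    then show ?case by auto
  qed
  then show ?thesis using that by blast
qed

text \<open>Diminishing returns, in place of submodularity. A basis of \<open>X\<close> is enlarged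
  to a basis of \<open>Y\<close> and then of \<open>insert x Y\<close>. If \<open>x\<close> raised
  the rank of \<open>Y\<close>, the last basis would contain \<open>x\<close>, so \<open>x\<close>
  would be independent of the basis of \<open>X\<close>.\<close>

lemma rk_insert_eq_mono:
  assumes "rk M (insert x X) = rk M X" "X \<subseteq> Y"
  shows "rk M (insert x Y) = rk M Y"
proof (rule ccontr)
  assume neq: "rk M (insert x Y) \<noteq> rk M Y"
  obtain I where I: "I \<subseteq> X" "indep M I" "card I = rk M X"
    by (rule obtain_basis)
  obtain J where J: "I \<subseteq> J" "J \<subseteq> Y" "indep M J" "card J = rk M Y"
    using extend_to_basis[OF I(2), of Y] I(1) assms(2) by blast
  obtain K where K: "J \<subseteq> K" "K \<subseteq> insert x Y" "indep M K" "card K = rk M (insert x Y)"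
    using extend_to_basis[OF J(3), of "insert x Y"] J(2) by blast
  have "\<not> K \<subseteq> Y"
    using neq K(4) card_le_rk[OF K(3), of Y] rk_insert_cases[of x Y] by auto
  moreover have "x \<notin> Y" using neq by (auto simp: insert_absorb)
  ultimately have x: "x \<in> K" "x \<notin> J" using K(2) J(2) by auto
  then have "indep M (insert x I)"
    using K J I by (intro indep_subset[OF K(3)]) auto
  then have "card (insert x I) \<le> rk M (insert x X)"
    using I by (intro card_le_rk) auto
  moreover have "card (insert x I) = Suc (card I)"
    using finite_indep[OF I(2)] x J by (subst card_insert_disjoint) auto
  ultimately show False using assms I by simp
qed

lemma rk_Un_eq:
  assumes "\<And>z. z \<in> Z \<Longrightarrow> rk M (insert z X) = rk M X" "finite Z"
  shows "rk M (X \<union> Z) = rk M X"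
  using assms(2,1)
proof (induction Z)
  case (insert z Z)
  have "rk M (insert z (X \<union> Z)) = rk M (X \<union> Z)"
    using insert.prems[of z] by (rule rk_insert_eq_mono) auto
  moreover have "rk M (X \<union> Z) = rk M X" using insert.prems by (intro insert.IH) blast
  ultimately show ?case by simp
qed simp

lemma cl_subset_ground: "cl M X \<subseteq> ground M"
  by (auto simp: cl_def)

lemma finite_cl: "finite (cl M X)"
  using cl_subset_ground finite_ground finite_subset by blast

lemma cl_extensive: "X \<subseteq> ground M \<Longrightarrow> X \<subseteq> cl M X"
  by (auto simp: cl_def insert_absorb)

lemma cl_mono: "X \<subseteq> Y \<Longrightarrow> cl M X \<subseteq> cl M Y"
  by (auto simp: cl_def intro: rk_insert_eq_mono)

lemma rk_cl: "X \<subseteq> ground M \<Longrightarrow> rk M (cl M X) = rk M X"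
  using rk_Un_eq[of "cl M X" X, OF _ finite_cl] cl_extensive[of X]
  by (auto simp: cl_def Un_absorb1)

lemma in_cl_if_rk_le:
  "x \<in> ground M \<Longrightarrow> rk M (insert x X) \<le> rk M X \<Longrightarrow> x \<in> cl M X"
  using rk_insert_cases[of x X] by (auto simp: cl_def)

lemma cl_cl: assumes "X \<subseteq> ground M" shows "cl M (cl M X) = cl M X"
proof
  show "cl M (cl M X) \<subseteq> cl M X"
  proof
    fix x assume x: "x \<in> cl M (cl M X)"
    have "rk M (insert x X) \<le> rk M (insert x (cl M X))"
      using cl_extensive[OF assms] by (intro rk_mono) auto
    also have "\<dots> = rk M X" using x rk_cl[OF assms] by (simp add: cl_def)
    finally show "x \<in> cl M X"
      using x cl_subset_ground by (intro in_cl_if_rk_le) auto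
  qed
qed (use assms cl_extensive cl_mono in blast)

lemma cl_subset_iff:
  "X \<subseteq> ground M \<Longrightarrow> Y \<subseteq> ground M \<Longrightarrow> cl M X \<subseteq> cl M Y \<longleftrightarrow> X \<subseteq> cl M Y"
  using cl_cl[of Y] cl_extensive[of X] cl_mono[of X "cl M Y"] by auto

lemma rk_insert_notin_cl: "x \<in> ground M \<Longrightarrow> x \<notin> cl M X \<Longrightarrow> rk M (insert x X) = Suc (rk M X)"
  using rk_insert_cases[of x X] by (auto simp: cl_def)

lemma rk_insert_in_cl: "x \<in> cl M X \<Longrightarrow> rk M (insert x X) = rk M X"
  by (simp add: cl_def)

text \<open>Mac Lane-Steinitz exchange: adding \<open>x\<close> to \<open>X\<close> raises the rank
  by at most one, and \<open>y\<close> alone already achieves that, so nothing is left for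
  \<open>x\<close> to add.\<close>

lemma cl_exchange:
  assumes "x \<in> ground M" "y \<in> cl M (insert x X)" "y \<notin> cl M X"
  shows "x \<in> cl M (insert y X)"
proof (rule in_cl_if_rk_le[OF assms(1)])
  have y: "y \<in> ground M" using assms(2) cl_subset_ground by auto
  have "rk M (insert x (insert y X)) = rk M (insert x X)"
    using assms(2) by (simp add: cl_def insert_commute)
  then show "rk M (insert x (insert y X)) \<le> rk M (insert y X)"
    using rk_insert_notin_cl[OF y assms(3)] rk_insert_le[of x X] by simp
qed

lemma is_flatI: "X \<subseteq> ground M \<Longrightarrow> cl M X \<subseteq> X \<Longrightarrow> is_flat M X"
  using cl_extensive by (auto simp: is_flat_def)

lemma is_flat_cl: "X \<subseteq> ground M \<Longrightarrow> is_flat M (cl M X)"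
  by (simp add: is_flat_def cl_cl cl_subset_ground)

lemma is_flat_ground: "is_flat M (ground M)"
  by (intro is_flatI) (auto simp: cl_subset_ground)

lemma is_flat_Int: "is_flat M F \<Longrightarrow> is_flat M G \<Longrightarrow> is_flat M (F \<inter> G)"
  using cl_mono[of "F \<inter> G" F] cl_mono[of "F \<inter> G" G] by (intro is_flatI) (auto simp: is_flat_def)

lemma flat_finite: "is_flat M F \<Longrightarrow> finite F"
  using finite_ground finite_subset by (auto simp: is_flat_def)

lemma cl_subset_flat: "is_flat M F \<Longrightarrow> X \<subseteq> F \<Longrightarrow> cl M X \<subseteq> F"
  using cl_mono[of X F] by (auto simp: is_flat_def)

lemma cl_eq_if_rk_le:
  assumes "X \<subseteq> Y" "Y \<subseteq> ground M" "rk M Y \<le> rk M X"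
  shows "cl M X = cl M Y"
proof
  have "Y \<subseteq> cl M X"
  proof
    fix y assume "y \<in> Y"
    then have "rk M (insert y X) \<le> rk M Y" using assms by (intro rk_mono) auto
    then show "y \<in> cl M X" using \<open>y \<in> Y\<close> assms by (intro in_cl_if_rk_le) auto
  qed
  then show "cl M Y \<subseteq> cl M X" using assms cl_subset_iff[of Y X] by auto
qed (rule cl_mono[OF assms(1)])

lemma flat_eqI:
  assumes "is_flat M G" "is_flat M F" "G \<subseteq> F" "rk M F \<le> rk M G"
  shows "G = F"
  using cl_eq_if_rk_le[of G F] assms by (auto simp: is_flat_def)

text \<open>The closure of a subset of \<open>F\<close> stays inside \<open>F\<close>, so only
  points of \<open>F\<close> need testing. Ranks of subsets of \<open>F\<close> are what a
  rank-preserving bijection between flats can carry over.\<close>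

lemma flat_subset_iff_rk:
  assumes F: "is_flat M F" and G: "G \<subseteq> F"
  shows "is_flat M G \<longleftrightarrow> (\<forall>x \<in> F - G. rk M (insert x G) \<noteq> rk M G)"
proof
  assume R: "\<forall>x \<in> F - G. rk M (insert x G) \<noteq> rk M G"
  show "is_flat M G"
  proof (rule is_flatI)
    show "G \<subseteq> ground M" using assms by (auto simp: is_flat_def)
    show "cl M G \<subseteq> G" using R cl_subset_flat[OF F G] by (auto simp: cl_def)
  qed
next
  assume "is_flat M G"
  then show "\<forall>x \<in> F - G. rk M (insert x G) \<noteq> rk M G"
    using F by (auto simp: is_flat_def cl_def)
qed

end

section \<open>Rank and closure under isomorphism and restriction\<close>

lemma rk_isomorphism:
  assumes f: "bij_betw f (ground M) (ground N)"
    and I: "\<And>X. X \<subseteq> ground M \<Longrightarrow> indep M X \<longleftrightarrow> indep N (f ` X)"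
    and X: "X \<subseteq> ground M"
  shows "rk N (f ` X) = rk M X"
proof -
  have inj: "inj_on f X" using f X by (meson bij_betw_def inj_on_subset)
  have "{card J | J. J \<subseteq> f ` X \<and> indep N J} = {card I | I. I \<subseteq> X \<and> indep M I}"
  proof (intro equalityI subsetI; clarify)
    fix J assume J: "J \<subseteq> f ` X" "indep N J"
    then obtain I' where "I' \<subseteq> X" "J = f ` I'" by (meson subset_imageE)
    then show "\<exists>I'. card J = card I' \<and> I' \<subseteq> X \<and> indep M I'"
      using J I[of I'] X card_image[OF inj_on_subset[OF inj, of I']] by (intro exI[of _ I']) auto
  next
    fix I' assume "I' \<subseteq> X" "indep M I'"
    then show "\<exists>J. card I' = card J \<and> J \<subseteq> f ` X \<and> indep N J"
      using I[of I'] X card_image[OF inj_on_subset[OF inj, of I']] by (intro exI[of _ "f ` I'"]) auto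
  qed
  then show ?thesis by (simp add: rk_def)
qed

lemma matroid_restriction: assumes "matroid M" shows "matroid (restriction M X)"
proof -
  interpret matroid M by fact
  show ?thesis
  proof
    fix I J assume *: "indep (restriction M X) I" "indep (restriction M X) J" "card I < card J"
    then obtain y where "y \<in> J - I" "indep M (insert y I)"
      using augment[of I J] by (auto simp: restriction_def)
    with * show "\<exists>y \<in> J - I. indep (restriction M X) (insert y I)"
      by (auto simp: restriction_def)
  next
    fix I J assume "indep (restriction M X) I" "J \<subseteq> I"
    then show "indep (restriction M X) J"
      using indep_subset[of I J] by (auto simp: restriction_def)
  next
    fix I assume "indep (restriction M X) I"
    then show "I \<subseteq> ground (restriction M X)"
      using indep_subset_ground[of I] by (auto simp: restriction_def)
  qed (use finite_ground indep_empty in \<open>auto simp: restriction_def\<close>)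
qed

lemma rk_restriction: "Y \<subseteq> X \<Longrightarrow> rk (restriction M X) Y = rk M Y"
  unfolding rk_def restriction_def by (rule arg_cong[of _ _ Max]) auto

lemma cl_restriction: "Y \<subseteq> X \<Longrightarrow> cl (restriction M X) Y = cl M Y \<inter> X"
  using rk_restriction[of Y X M] rk_restriction[of "insert _ Y" X M]
  by (auto simp: cl_def restriction_def[of M X, THEN arg_cong[of _ _ ground]])

section \<open>Compositions of flags\<close>

lemma image_mset_sum: "image_mset f (\<Sum>x\<in>A. g x) = (\<Sum>x\<in>A. image_mset f (g x))"
  by (induction A rule: infinite_finite_induct) auto

lemma sum_mset_image_sum:
  "(\<Sum>b\<in>#(\<Sum>x\<in>A. g x). h b) = (\<Sum>x\<in>A. \<Sum>b\<in>#g x. h b)"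
  by (induction A rule: infinite_finite_induct) auto

lemma sum_mset_eq_sum_count:
  fixes f :: "'a \<Rightarrow> nat"
  assumes "finite U" "set_mset A \<subseteq> U"
  shows "(\<Sum>c\<in>#A. f c) = (\<Sum>c\<in>U. count A c * f c)"
  using assms(2)
proof (induction A)
  case (add x A)
  have "(\<Sum>c\<in>U. count (add_mset x A) c * f c) = (\<Sum>c\<in>U. count A c * f c + (if c = x then f c else 0))"
    by (intro sum.cong) auto
  also have "\<dots> = (\<Sum>c\<in>U. count A c * f c) + f x"
    using assms(1) add.prems by (simp add: sum.distrib)
  finally show ?case using add by simp
qed simp

definition lower_covers :: "'a set_system \<Rightarrow> 'a set \<Rightarrow> 'a set set" where
  "lower_covers M F = {G. is_flat M G \<and> G \<subseteq> F \<and> Suc (rk M G) = rk M F}"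

text \<open>The multiset of compositions of the maximal chains of flats ending in a flat \<open>F\<close> of
  rank \<open>k\<close>; the rank is passed along to make the recursion primitive.\<close>

primrec flag_comps :: "'a set_system \<Rightarrow> nat \<Rightarrow> 'a set \<Rightarrow> nat list multiset" where
  "flag_comps M 0 F = {#[card F]#}"
| "flag_comps M (Suc k) F =
     (\<Sum>G\<in>lower_covers M F. image_mset (\<lambda>c. c @ [card (F - G)]) (flag_comps M k G))"

definition catenary_mset :: "'a set_system \<Rightarrow> nat list multiset" where
  "catenary_mset M = flag_comps M (rk M (ground M)) (ground M)"

text \<open>Unlike in \<open>flags\<close>, the end and the length of the chain are free, so that a
  flag can be cut before its last flat and induction applies.\<close>

definition flags_to :: "'a set_system \<Rightarrow> nat \<Rightarrow> 'a set \<Rightarrow> 'a set list set" where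
  "flags_to M k F = {X. length X = Suc k \<and> (\<forall>j \<le> k. is_flat M (X ! j) \<and> rk M (X ! j) = j) \<and>
     (\<forall>j < k. X ! j \<subset> X ! Suc j) \<and> X ! k = F}"

lemma flag_composition_snoc:
  assumes "length X = Suc k" "X ! k = G"
  shows "flag_composition (X @ [F]) = flag_composition X @ [card (F - G)]"
  using assms by (simp add: flag_composition_def nth_append)

context matroid
begin

lemma finite_lower_covers: "finite (lower_covers M F)"
  by (rule finite_subset[of _ "Pow (ground M)"])
     (auto simp: lower_covers_def is_flat_def finite_ground)

lemma finite_flags_to: "finite (flags_to M k F)"
proof (rule finite_subset)
  show "flags_to M k F \<subseteq> {X. set X \<subseteq> Pow (ground M) \<and> length X = Suc k}"
    by (auto simp: flags_to_def is_flat_def in_set_conv_nth less_Suc_eq_le) blast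
  show "finite {X. set X \<subseteq> Pow (ground M) \<and> length X = Suc k}"
    using finite_ground by (intro finite_lists_length_eq) auto
qed

lemma flags_to_Suc:
  assumes "is_flat M F" "rk M F = Suc k"
  shows "flags_to M (Suc k) F = (\<Union>G\<in>lower_covers M F. (\<lambda>X. X @ [F]) ` flags_to M k G)"
proof (intro equalityI subsetI)
  fix X assume X: "X \<in> flags_to M (Suc k) F"
  define Y where "Y = butlast X"
  have XY: "X = Y @ [F]" "length Y = Suc k"
    using X by (auto simp: flags_to_def Y_def)
       (metis Suc_neq_Zero append_butlast_last_id diff_Suc_1 last_conv_nth list.size(3))
  have nth: "X ! j = Y ! j" if "j \<le> k" for j
    using that XY by (simp add: nth_append)
  have "is_flat M (X ! k)" "rk M (X ! k) = k" "X ! k \<subset> X ! Suc k" "X ! Suc k = F"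
    using X by (auto simp: flags_to_def)
  then have "Y ! k \<in> lower_covers M F"
    using assms(2) nth[of k] by (auto simp: lower_covers_def)
  moreover have "is_flat M (Y ! j) \<and> rk M (Y ! j) = j" if "j \<le> k" for j
  proof -
    have "is_flat M (X ! j) \<and> rk M (X ! j) = j" using X that unfolding flags_to_def by simp
    then show ?thesis using nth[OF that] by simp
  qed
  moreover have "Y ! j \<subset> Y ! Suc j" if "j < k" for j
  proof -
    have "X ! j \<subset> X ! Suc j" using X that unfolding flags_to_def by auto
    then show ?thesis using nth[of j] nth[of "Suc j"] that by simp
  qed
  ultimately have "Y \<in> flags_to M k (Y ! k)" using XY by (auto simp: flags_to_def)
  with \<open>Y ! k \<in> lower_covers M F\<close>
  show "X \<in> (\<Union>G\<in>lower_covers M F. (\<lambda>X. X @ [F]) ` flags_to M k G)" using XY by auto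
next
  fix X assume "X \<in> (\<Union>G\<in>lower_covers M F. (\<lambda>X. X @ [F]) ` flags_to M k G)"
  then obtain G Y where G: "is_flat M G" "G \<subseteq> F" "rk M G = k" and XY: "X = Y @ [F]"
    and Y: "Y \<in> flags_to M k G"
    using assms(2) by (auto simp: lower_covers_def)
  have "G \<noteq> F" using G(3) assms(2) by auto
  then have "G \<subset> F" using G(2) by auto
  then show "X \<in> flags_to M (Suc k) F"
    using assms XY Y by (auto simp: flags_to_def nth_append le_Suc_eq less_Suc_eq)
qed

lemma flag_comps_eq_flags_to:
  "is_flat M F \<Longrightarrow> rk M F = k \<Longrightarrow> flag_comps M k F = (\<Sum>X\<in>flags_to M k F. {#flag_composition X#})"
proof (induction k arbitrary: F)
  case 0
  then have "flags_to M 0 F = {[F]}"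
    by (auto simp: flags_to_def length_Suc_conv)
  then show ?case by (simp add: flag_composition_def)
next
  case (Suc k)
  have "(\<Sum>X\<in>flags_to M (Suc k) F. {#flag_composition X#}) =
    (\<Sum>G\<in>lower_covers M F. \<Sum>X\<in>(\<lambda>X. X @ [F]) ` flags_to M k G. {#flag_composition X#})"
    unfolding flags_to_Suc[OF Suc.prems]
    \<comment> \<open>The sets for distinct \<open>G\<close> are disjoint, because \<open>G\<close>
      is the next-to-last entry of each list in its set.\<close>
    by (rule sum.UNION_disjoint) (use finite_lower_covers finite_flags_to in \<open>auto simp: flags_to_def\<close>)
  also have "\<dots> = (\<Sum>G\<in>lower_covers M F. \<Sum>X\<in>flags_to M k G. {#flag_composition (X @ [F])#})"
    by (subst sum.reindex) (auto simp: inj_on_def)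
  also have "\<dots> = flag_comps M (Suc k) F"
    unfolding flag_comps.simps
  proof (rule sum.cong[OF refl])
    fix G assume "G \<in> lower_covers M F"
    then have G: "is_flat M G" "rk M G = k" using Suc.prems by (auto simp: lower_covers_def)
    have "(\<Sum>X\<in>flags_to M k G. {#flag_composition (X @ [F])#}) =
      (\<Sum>X\<in>flags_to M k G. {#flag_composition X @ [card (F - G)]#})"
      by (intro sum.cong refl arg_cong[where f = "\<lambda>x. {#x#}"] flag_composition_snoc)
         (auto simp: flags_to_def)
    then show "(\<Sum>X\<in>flags_to M k G. {#flag_composition (X @ [F])#}) =
      image_mset (\<lambda>c. c @ [card (F - G)]) (flag_comps M k G)"
      by (simp add: Suc.IH[OF G] image_mset_sum)
  qed
  finally show ?case by simp
qed

lemma nu_eq_count: "nu M a = count (catenary_mset M) a"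
proof -
  have "flags M = flags_to M (rk M (ground M)) (ground M)"
    by (simp add: flags_def flags_to_def Let_def)
  moreover have "count (catenary_mset M) a =
    (\<Sum>X\<in>flags_to M (rk M (ground M)) (ground M). if flag_composition X = a then 1 else 0)"
    unfolding catenary_mset_def flag_comps_eq_flags_to[OF is_flat_ground refl] count_sum
    by (intro sum.cong) auto
  ultimately show ?thesis
    using sum.inter_filter[OF finite_flags_to, of "\<lambda>_. 1" _ _ "\<lambda>X. flag_composition X = a"]
    by (simp only: nu_def card_eq_sum)
qed

text \<open>The first entry is the size of the rank 0 flat, the set of loops, and may be zero. Later
  entries are positive since flats of different rank differ.\<close>

lemma flag_comps_props:
  "is_flat M F \<Longrightarrow> rk M F = k \<Longrightarrow> b \<in># flag_comps M k F \<Longrightarrow>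
    length b = Suc k \<and> sum_list b = card F \<and> (\<forall>y\<in>set (tl b). y > 0)"
proof (induction k arbitrary: F b)
  case (Suc k)
  have "b \<in> (\<Union>G\<in>lower_covers M F. (\<lambda>c. c @ [card (F - G)]) ` set_mset (flag_comps M k G))"
    using Suc.prems(3) by (simp add: set_mset_sum finite_lower_covers)
  then obtain G c where G: "is_flat M G" "G \<subseteq> F" "rk M G = k"
    and b: "b = c @ [card (F - G)]" and c: "c \<in># flag_comps M k G"
    using Suc.prems(2) by (auto simp: lower_covers_def)
  have "finite F" using Suc.prems flat_finite by auto
  moreover have "G \<noteq> F" using G Suc.prems by auto
  ultimately have "card G < card F" using G(2) by (auto intro: psubset_card_mono)
  then have "0 < card (F - G)" "card F = card G + card (F - G)"
    using card_Diff_subset[OF finite_subset[OF G(2) \<open>finite F\<close>] G(2)] by auto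
  moreover have "c \<noteq> []" using Suc.IH[OF G(1,3) c] by auto
  ultimately show ?case using Suc.IH[OF G(1,3) c] b by auto
qed simp

lemma catenary_mset_props:
  assumes "b \<in># catenary_mset M"
  shows "length b = Suc (rk M (ground M))" "sum_list b = card (ground M)" "\<forall>y\<in>set (tl b). y > 0"
  using flag_comps_props[OF is_flat_ground refl, of b] assms by (auto simp: catenary_mset_def)

text \<open>Needed to see that the restricted index set of \<open>catenary_data\<close> hides no
  flag.\<close>

lemma catenary_mset_compositions:
  assumes "b \<in># catenary_mset M"
  shows "b \<in> compositions (card (ground M)) (rk M (ground M))"
proof -
  have "b ! j > 0" if "j \<in> {1..rk M (ground M)}" for j
  proof -
    have "tl b ! (j - 1) \<in> set (tl b)"
      using that catenary_mset_props(1)[OF assms] by (intro nth_mem) auto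
    moreover have "tl b ! (j - 1) = b ! j"
      using that catenary_mset_props(1)[OF assms] by (subst nth_tl) auto
    ultimately show ?thesis using catenary_mset_props(3)[OF assms] by auto
  qed
  then show ?thesis using catenary_mset_props[OF assms] by (auto simp: compositions_def)
qed

end

section \<open>Rank sequences\<close>

text \<open>The number of injective sequences with a given rank sequence whose initial segments have as
  closures the members of a given flag of composition \<open>b\<close>; the rank sequence is given in reverse.\<close>

primrec seq_weight :: "nat list \<Rightarrow> nat list \<Rightarrow> nat" where
  "seq_weight b [] = (if length b = 1 then 1 else 0)"
| "seq_weight b (x # s) =
     (if x = 0 then seq_weight b s * (sum_list b - length s)
      else if x = 1 then seq_weight (butlast b) s * last b else 0)"

text \<open>The lists need not exhaust \<open>F\<close>: initial segments of permutations must be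
  included for an induction on the rank sequence.\<close>

definition spanning_lists :: "'a set_system \<Rightarrow> 'a set \<Rightarrow> nat list \<Rightarrow> 'a list set" where
  "spanning_lists M F s = {\<pi>. distinct \<pi> \<and> set \<pi> \<subseteq> F \<and> cl M (set \<pi>) = F \<and> rank_sequence M \<pi> = s}"

lemma rank_sequence_Nil [simp]: "rank_sequence M [] = []"
  by (simp add: rank_sequence_def)

lemma rank_sequence_snoc:
  "rank_sequence M (\<pi> @ [y]) =
     rank_sequence M \<pi> @ [rk M (insert y (set \<pi>)) - rk M (set \<pi>)]"
  by (auto simp: rank_sequence_def)

lemma length_rank_sequence [simp]: "length (rank_sequence M \<pi>) = length \<pi>"
  by (simp add: rank_sequence_def)

lemma seq_weight_Nil [simp]: "seq_weight [] s = 0"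
  by (induction s) auto

context matroid
begin

lemma finite_spanning_lists: "is_flat M F \<Longrightarrow> finite (spanning_lists M F s)"
  using finite_lists_length_eq[OF flat_finite, of F "length s"]
  by (rule finite_subset[rotated]) (auto simp: spanning_lists_def)

lemma spanning_lists_snoc_0:
  assumes F: "is_flat M F"
  shows "spanning_lists M F (s @ [0]) =
    (\<lambda>(\<pi>, y). \<pi> @ [y]) ` (SIGMA \<pi>:spanning_lists M F s. F - set \<pi>)"
proof (intro equalityI subsetI)
  fix \<rho> assume \<rho>: "\<rho> \<in> spanning_lists M F (s @ [0])"
  then have "\<rho> \<noteq> []" by (auto simp: spanning_lists_def)
  then obtain \<pi> y where \<rho>': "\<rho> = \<pi> @ [y]" by (metis rev_exhaust)
  have *: "distinct (\<pi> @ [y])" "set \<pi> \<subseteq> F" "y \<in> F" "cl M (insert y (set \<pi>)) = F"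
    "rank_sequence M \<pi> = s" "rk M (insert y (set \<pi>)) - rk M (set \<pi>) = 0"
    using \<rho> by (auto simp: spanning_lists_def \<rho>' rank_sequence_snoc)
  then have "cl M (set \<pi>) = cl M (insert y (set \<pi>))"
    using F by (intro cl_eq_if_rk_le) (auto simp: is_flat_def)
  then show "\<rho> \<in> (\<lambda>(\<pi>, y). \<pi> @ [y]) ` (SIGMA \<pi>:spanning_lists M F s. F - set \<pi>)"
    using * by (auto simp: spanning_lists_def \<rho>' intro!: image_eqI[of _ _ "(\<pi>, y)"])
next
  fix \<rho> assume "\<rho> \<in> (\<lambda>(\<pi>, y). \<pi> @ [y]) ` (SIGMA \<pi>:spanning_lists M F s. F - set \<pi>)"
  then obtain \<pi> y where \<rho>: "\<rho> = \<pi> @ [y]" and \<pi>: "\<pi> \<in> spanning_lists M F s" and y: "y \<in> F - set \<pi>"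
    by auto
  have "rk M (insert y (set \<pi>)) = rk M (set \<pi>)"
    using \<pi> y by (intro rk_insert_in_cl) (auto simp: spanning_lists_def)
  moreover have "cl M (set \<pi>) = cl M (insert y (set \<pi>))"
    using calculation y \<pi> F by (intro cl_eq_if_rk_le) (auto simp: is_flat_def spanning_lists_def)
  ultimately show "\<rho> \<in> spanning_lists M F (s @ [0])"
    using \<pi> y by (auto simp: spanning_lists_def \<rho> rank_sequence_snoc)
qed

text \<open>A last entry that raises the rank follows a prefix spanning some flat \<open>G\<close>
  covered by \<open>F\<close>. Any point of \<open>F - G\<close> can come last, since together with
  \<open>G\<close> it spans \<open>F\<close>.\<close>

lemma spanning_lists_snoc_1:
  assumes F: "is_flat M F"
  shows "spanning_lists M F (s @ [1]) =
    (\<lambda>(G, \<pi>, y). \<pi> @ [y]) ` (SIGMA G:lower_covers M F. spanning_lists M G s \<times> (F - G))"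
proof (intro equalityI subsetI)
  fix \<rho> assume \<rho>: "\<rho> \<in> spanning_lists M F (s @ [1])"
  then have "\<rho> \<noteq> []" by (auto simp: spanning_lists_def)
  then obtain \<pi> y where \<rho>': "\<rho> = \<pi> @ [y]" by (metis rev_exhaust)
  have *: "distinct (\<pi> @ [y])" "set \<pi> \<subseteq> F" "y \<in> F" "cl M (insert y (set \<pi>)) = F"
    "rank_sequence M \<pi> = s" "rk M (insert y (set \<pi>)) - rk M (set \<pi>) = 1"
    using \<rho> by (auto simp: spanning_lists_def \<rho>' rank_sequence_snoc)
  define G where "G = cl M (set \<pi>)"
  have sub: "insert y (set \<pi>) \<subseteq> ground M" using * F by (auto simp: is_flat_def)
  have rk: "rk M (insert y (set \<pi>)) = Suc (rk M (set \<pi>))"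
    using *(6) rk_insert_cases[of y "set \<pi>"] by auto
  have "Suc (rk M G) = rk M F"
    using rk_cl[OF sub] rk_cl[of "set \<pi>"] sub rk *(4) by (simp add: G_def)
  moreover have "is_flat M G" using sub by (simp add: G_def is_flat_cl)
  moreover have "G \<subseteq> F" using cl_subset_flat[OF F *(2)] by (simp add: G_def)
  moreover have "y \<notin> G" using rk rk_insert_in_cl[of y "set \<pi>"] by (auto simp: G_def)
  moreover have "set \<pi> \<subseteq> G" using cl_extensive sub by (auto simp: G_def)
  ultimately show "\<rho> \<in> (\<lambda>(G, \<pi>, y). \<pi> @ [y]) `
      (SIGMA G:lower_covers M F. spanning_lists M G s \<times> (F - G))"
    using * by (intro image_eqI[of _ _ "(G, \<pi>, y)"])
      (auto simp: \<rho>' lower_covers_def spanning_lists_def G_def)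
next
  fix \<rho> assume "\<rho> \<in> (\<lambda>(G, \<pi>, y). \<pi> @ [y]) `
      (SIGMA G:lower_covers M F. spanning_lists M G s \<times> (F - G))"
  then obtain G \<pi> y where \<rho>: "\<rho> = \<pi> @ [y]" and G: "G \<in> lower_covers M F"
    and \<pi>: "\<pi> \<in> spanning_lists M G s" and y: "y \<in> F - G"
    by auto
  have \<pi>': "set \<pi> \<subseteq> G" "cl M (set \<pi>) = G" using \<pi> by (auto simp: spanning_lists_def)
  have sub: "insert y (set \<pi>) \<subseteq> F" "F \<subseteq> ground M"
    using \<pi>' G y F by (auto simp: lower_covers_def is_flat_def)
  have rk: "rk M (insert y (set \<pi>)) = Suc (rk M (set \<pi>))"
    using sub y \<pi>' by (intro rk_insert_notin_cl) auto
  have "rk M (set \<pi>) = rk M G" using rk_cl[of "set \<pi>"] sub \<pi>' by auto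
  then have "cl M (insert y (set \<pi>)) = F"
    using cl_eq_if_rk_le[OF sub] rk G F by (auto simp: lower_covers_def is_flat_def)
  then show "\<rho> \<in> spanning_lists M F (s @ [1])"
    using \<pi> \<pi>' y sub rk by (auto simp: spanning_lists_def \<rho> rank_sequence_snoc)
qed

lemma card_spanning_lists:
  "is_flat M F \<Longrightarrow>
    card (spanning_lists M F (rev s)) = (\<Sum>b\<in>#flag_comps M (rk M F) F. seq_weight b s)"
proof (induction s arbitrary: F)
  case Nil
  have SL: "spanning_lists M F [] = (if cl M {} = F then {[]} else {})"
    by (auto simp: spanning_lists_def) (metis length_0_conv length_rank_sequence list.set(1))+
  show ?case
  proof (cases "rk M F = 0")
    case True
    then have "cl M {} = F"
      using Nil is_flat_cl[of "{}"] cl_subset_flat[OF Nil, of "{}"] by (intro flat_eqI) auto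
    then show ?thesis using True SL by simp
  next
    case False
    \<comment> \<open>In positive rank both sides vanish: the empty list does not span, and every
      composition has length at least two.\<close>
    then have "cl M {} \<noteq> F" using rk_cl[of "{}"] by auto
    moreover have "seq_weight b [] = 0" if "b \<in># flag_comps M (rk M F) F" for b
      using flag_comps_props[OF Nil refl that] False by simp
    ultimately show ?thesis using SL by simp
  qed
next
  case (Cons x s)
  have fin: "finite F" using Cons.prems flat_finite by auto
  consider "x = 0" | "x = 1" | "x > 1" by linarith
  then show ?case
  proof cases
    case 1
    have "card (spanning_lists M F (rev s @ [0])) = card (SIGMA \<pi>:spanning_lists M F (rev s). F - set \<pi>)"
      unfolding spanning_lists_snoc_0[OF Cons.prems] by (rule card_image) (auto simp: inj_on_def)
    also have "\<dots> = (\<Sum>\<pi>\<in>spanning_lists M F (rev s). card (F - set \<pi>))"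
      using finite_spanning_lists[OF Cons.prems] fin by (intro card_SigmaI) auto
    also have "\<dots> = (\<Sum>\<pi>\<in>spanning_lists M F (rev s). card F - length s)"
    proof (rule sum.cong[OF refl])
      fix \<pi> assume "\<pi> \<in> spanning_lists M F (rev s)"
      then have "distinct \<pi>" "set \<pi> \<subseteq> F" "length \<pi> = length s"
        by (auto simp: spanning_lists_def) (metis length_rank_sequence length_rev)
      then show "card (F - set \<pi>) = card F - length s"
        by (simp add: card_Diff_subset distinct_card)
    qed
    also have "\<dots> = (\<Sum>b\<in>#flag_comps M (rk M F) F. seq_weight b s) * (card F - length s)"
      using Cons.IH[OF Cons.prems] by simp
    also have "\<dots> = (\<Sum>b\<in>#flag_comps M (rk M F) F. seq_weight b s * (card F - length s))"
      by (simp add: sum_mset_distrib_right)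
    \<comment> \<open>All compositions of flags ending in \<open>F\<close> have sum
      \<open>card F\<close>.\<close>
    also have "\<dots> = (\<Sum>b\<in>#flag_comps M (rk M F) F. seq_weight b (0 # s))"
      using flag_comps_props[OF Cons.prems refl]
      by (intro arg_cong[where f = sum_mset] image_mset_cong) auto
    finally show ?thesis using 1 by simp
  next
    case 2
    have "card (spanning_lists M F (rev s @ [1])) =
      card (SIGMA G:lower_covers M F. spanning_lists M G (rev s) \<times> (F - G))"
      unfolding spanning_lists_snoc_1[OF Cons.prems]
      by (rule card_image) (auto simp: inj_on_def spanning_lists_def)
    also have "\<dots> = (\<Sum>G\<in>lower_covers M F. card (spanning_lists M G (rev s)) * card (F - G))"
      using finite_spanning_lists fin finite_lower_covers
      by (subst card_SigmaI) (auto simp: lower_covers_def card_cartesian_product)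
    also have "\<dots> = (\<Sum>G\<in>lower_covers M F.
        (\<Sum>b\<in>#flag_comps M (rk M G) G. seq_weight b s) * card (F - G))"
      using Cons.IH by (intro sum.cong) (auto simp: lower_covers_def)
    also have "\<dots> = (\<Sum>b\<in>#flag_comps M (rk M F) F. seq_weight b (1 # s))"
    proof (cases "rk M F")
      case 0
      then have "lower_covers M F = {}" by (auto simp: lower_covers_def)
      then show ?thesis using 0 by simp
    next
      case (Suc k)
      have "(\<Sum>b\<in>#flag_comps M (rk M F) F. seq_weight b (1 # s)) =
        (\<Sum>G\<in>lower_covers M F. \<Sum>b\<in>#flag_comps M k G. seq_weight b s * card (F - G))"
        by (simp add: Suc sum_mset_image_sum image_mset.compositionality comp_def)
      also have "\<dots> = (\<Sum>G\<in>lower_covers M F.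
        (\<Sum>b\<in>#flag_comps M (rk M G) G. seq_weight b s) * card (F - G))"
        using Suc by (intro sum.cong) (auto simp: lower_covers_def sum_mset_distrib_right)
      finally show ?thesis by simp
    qed
    finally show ?thesis using 2 by simp
  next
    case 3
    have "spanning_lists M F (rev s @ [x]) = {}"
    proof (intro equals0I)
      fix \<rho> assume \<rho>: "\<rho> \<in> spanning_lists M F (rev s @ [x])"
      then have "\<rho> \<noteq> []" by (auto simp: spanning_lists_def)
      then obtain \<pi> y where \<rho>': "\<rho> = \<pi> @ [y]" by (metis rev_exhaust)
      have "rk M (insert y (set \<pi>)) - rk M (set \<pi>) = x"
        using \<rho> by (auto simp: spanning_lists_def \<rho>' rank_sequence_snoc)
      then show False using 3 rk_insert_cases[of y "set \<pi>"] by auto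
    qed
    then show ?thesis using 3 by simp
  qed
qed

section \<open>The coefficients of \<open>G_invariant\<close>\<close>

lemma lookup_G_invariant:
  "Poly_Mapping.lookup (G_invariant M :: nat list \<Rightarrow>\<^sub>0 'k::field_char_0) (rev s) =
    (if length s = card (ground M) then of_nat (\<Sum>b\<in>#catenary_mset M. seq_weight b s) else 0)"
proof -
  let ?P = "permutations_of_set (ground M)"
  have "Poly_Mapping.lookup (G_invariant M :: nat list \<Rightarrow>\<^sub>0 'k) (rev s) =
    (\<Sum>\<pi>\<in>?P. if rank_sequence M \<pi> = rev s then 1 else 0)"
    by (simp add: G_invariant_def lookup_sum lookup_single when_def)
  also have "\<dots> = of_nat (card {\<pi>\<in>?P. rank_sequence M \<pi> = rev s})"
    by (simp flip: sum.inter_filter)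
  also have "{\<pi>\<in>?P. rank_sequence M \<pi> = rev s} =
    (if length s = card (ground M) then spanning_lists M (ground M) (rev s) else {})"
  proof (cases "length s = card (ground M)")
    case True
    have "\<pi> \<in> ?P \<and> rank_sequence M \<pi> = rev s \<longleftrightarrow> \<pi> \<in> spanning_lists M (ground M) (rev s)" for \<pi>
    proof
      assume "\<pi> \<in> ?P \<and> rank_sequence M \<pi> = rev s"
      then show "\<pi> \<in> spanning_lists M (ground M) (rev s)"
        using is_flat_ground by (auto simp: spanning_lists_def permutations_of_set_def is_flat_def)
    next
      assume \<pi>: "\<pi> \<in> spanning_lists M (ground M) (rev s)"
      then have "length \<pi> = length s"
        by (auto simp: spanning_lists_def) (metis length_rank_sequence length_rev)
      \<comment> \<open>Length and distinctness force a spanning list to use every point.\<close>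
      then have "set \<pi> = ground M"
        using \<pi> True finite_ground
        by (intro card_subset_eq) (auto simp: spanning_lists_def distinct_card)
      then show "\<pi> \<in> ?P \<and> rank_sequence M \<pi> = rev s"
        using \<pi> by (auto simp: spanning_lists_def permutations_of_set_def)
    qed
    then show ?thesis using True by auto
  next
    case False
    have "length s = card (ground M)" if "\<pi> \<in> ?P" "rank_sequence M \<pi> = rev s" for \<pi>
      using that by (metis length_rank_sequence length_rev length_finite_permutations_of_set)
    with False show ?thesis by auto
  qed
  finally show ?thesis
    by (simp add: card_spanning_lists[OF is_flat_ground] catenary_mset_def)
qed

text \<open>The coefficient at the rank sequence of any ordering is a positive count, hence nonzero
  in characteristic zero. It makes the size of the ground set readable from the invariant.\<close>

lemma G_invariant_nonzero:
  obtains s where "Poly_Mapping.lookup (G_invariant M :: nat list \<Rightarrow>\<^sub>0 'k::field_char_0) (rev s) \<noteq> 0"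
proof -
  obtain \<pi> where \<pi>: "set \<pi> = ground M" "distinct \<pi>"
    using finite_distinct_list[OF finite_ground] by auto
  define s where "s = rev (rank_sequence M \<pi>)"
  have len: "length s = card (ground M)" using \<pi> by (simp add: s_def distinct_card flip: \<pi>(1))
  have "\<pi> \<in> spanning_lists M (ground M) (rev s)"
    using \<pi> is_flat_ground by (auto simp: spanning_lists_def s_def is_flat_def)
  then have "card (spanning_lists M (ground M) (rev s)) \<noteq> 0"
    using finite_spanning_lists[OF is_flat_ground] by auto
  then show ?thesis
    using that[of s] len lookup_G_invariant[of s, where 'k = 'k]
    by (simp add: card_spanning_lists[OF is_flat_ground] catenary_mset_def del: of_nat_sum_mset)
qed

text \<open>Existence of a flag is read off from the invariant over \<open>real\<close>: without
  flags all coefficients would vanish.\<close>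

lemma catenary_mset_nonempty: "catenary_mset M \<noteq> {#}"
proof
  assume "catenary_mset M = {#}"
  then have "Poly_Mapping.lookup (G_invariant M :: nat list \<Rightarrow>\<^sub>0 real) (rev s) = 0" for s
    by (simp add: lookup_G_invariant)
  then show False using G_invariant_nonzero[where 'k = real] by blast
qed

end

theorem catenary_data_eq_iff:
  assumes "matroid M" "matroid N"
  shows "catenary_data M = catenary_data N \<longleftrightarrow> catenary_mset M = catenary_mset N"
proof -
  interpret M: matroid M by fact
  interpret N: matroid N by fact
  obtain b where b: "b \<in># catenary_mset M" using M.catenary_mset_nonempty by blast
  have same: "card (ground M) = card (ground N)" "rk M (ground M) = rk N (ground N)"
    if "b \<in> compositions (card (ground N)) (rk N (ground N))"
    using that M.catenary_mset_compositions[OF b] by (auto simp: compositions_def)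
  show ?thesis
  proof
    assume eq: "catenary_data M = catenary_data N"
    \<comment> \<open>One flag composition \<open>b\<close> of \<open>M\<close> suffices: it lies in
      the domain for \<open>N\<close> too, and its sum and length determine size and rank.\<close>
    have "catenary_data M b \<noteq> None"
      using M.catenary_mset_compositions[OF b] by (simp add: catenary_data_def)
    then have "catenary_data N b \<noteq> None" by (simp add: eq)
    then have nr: "card (ground M) = card (ground N)" "rk M (ground M) = rk N (ground N)"
      using same by (auto simp: catenary_data_def split: if_splits)
    show "catenary_mset M = catenary_mset N"
    proof (rule multiset_eqI)
      fix a
      show "count (catenary_mset M) a = count (catenary_mset N) a"
      proof (cases "a \<in> compositions (card (ground M)) (rk M (ground M))")
        case True
        then show ?thesis
          using fun_cong[OF eq, of a] nr
          by (simp add: catenary_data_def M.nu_eq_count N.nu_eq_count)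
      next
        case False
        then have "a \<notin># catenary_mset M" "a \<notin># catenary_mset N"
          using M.catenary_mset_compositions[of a] N.catenary_mset_compositions[of a] nr by auto
        then show ?thesis by (simp add: not_in_iff)
      qed
    qed
  next
    assume eq: "catenary_mset M = catenary_mset N"
    then have "card (ground M) = card (ground N)" "rk M (ground M) = rk N (ground N)"
      using same N.catenary_mset_compositions[of b] b by auto
    then show "catenary_data M = catenary_data N"
      using eq by (auto simp: catenary_data_def M.nu_eq_count N.nu_eq_count)
  qed
qed

section \<open>Triangularity of the linear system\<close>

text \<open>The reverse of the rank sequence that exhausts each flat of a flag before entering the
  next one.\<close>

definition rlead :: "nat list \<Rightarrow> nat list" where
  "rlead b = rev (replicate (hd b) 0 @ concat (map (\<lambda>y. 1 # replicate (y - 1) 0) (tl b)))"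

text \<open>For the composition of a flag this is the total size of its flats. It is strictly
  monotone for the coordinatewise order of partial sums and serves to pick an extreme
  composition.\<close>

definition partial_sums_total :: "nat list \<Rightarrow> nat" where
  "partial_sums_total b = (\<Sum>j<length b. sum_list (take (Suc j) b))"

lemma rlead_single: "rlead [y] = replicate y 0"
  by (simp add: rlead_def)

lemma rlead_snoc: "b \<noteq> [] \<Longrightarrow> rlead (b @ [y]) = replicate (y - 1) 0 @ 1 # rlead b"
  by (simp add: rlead_def)

lemma partial_sums_total_snoc:
  "partial_sums_total (b @ [y]) = partial_sums_total b + sum_list (b @ [y])"
  by (simp add: partial_sums_total_def)

lemma length_rlead:
  "b \<noteq> [] \<Longrightarrow> \<forall>y\<in>set (tl b). y > 0 \<Longrightarrow> length (rlead b) = sum_list b"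
proof (induction b rule: rev_nonempty_induct)
  case (snoc y b)
  then show ?case by (auto simp: rlead_snoc)
qed (simp add: rlead_single)

lemma seq_weight_replicate_pos:
  "seq_weight b s > 0 \<Longrightarrow> m + length s \<le> sum_list b \<Longrightarrow> seq_weight b (replicate m 0 @ s) > 0"
  by (induction m) auto

lemma seq_weight_replicate_nonzeroD:
  "seq_weight b (replicate m 0 @ s) \<noteq> 0 \<Longrightarrow> seq_weight b s \<noteq> 0"
  by (induction m) auto

lemma seq_weight_rlead_pos:
  "b \<noteq> [] \<Longrightarrow> \<forall>y\<in>set (tl b). y > 0 \<Longrightarrow> seq_weight b (rlead b) > 0"
proof (induction b rule: rev_nonempty_induct)
  case (single y)
  then show ?case using seq_weight_replicate_pos[of "[y]" "[]" y] by (simp add: rlead_single)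
next
  case (snoc y b)
  have "y > 0" "\<forall>y\<in>set (tl b). y > 0" using snoc by auto
  then show ?case
    using snoc length_rlead[of b] unfolding rlead_snoc[OF snoc.hyps(1)]
    by (intro seq_weight_replicate_pos) auto
qed

lemma seq_weight_nonzero_length: "seq_weight c s \<noteq> 0 \<Longrightarrow> length s \<le> sum_list c"
proof (induction s arbitrary: c)
  case (Cons x s)
  show ?case
  proof (cases "x = 0")
    case True
    with Cons show ?thesis by auto
  next
    case False
    with Cons.prems have *: "seq_weight (butlast c) s \<noteq> 0" "last c \<noteq> 0" "c \<noteq> []"
      by (auto split: if_splits)
    then have "sum_list c = sum_list (butlast c) + last c"
      by (metis add.right_neutral append_butlast_last_id sum_list.Cons sum_list.Nil sum_list_append)
    then show ?thesis using Cons.IH[OF *(1)] *(2) by auto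
  qed
qed auto

text \<open>In a sequence counted for \<open>c\<close>, the entries before each 1 must fit into the
  current flat of \<open>c\<close>. In \<open>rlead b\<close> they fill the current flat of
  \<open>b\<close>, so each partial sum of \<open>c\<close> is at least that of \<open>b\<close>,
  and equal totals force equality throughout.\<close>

lemma seq_weight_rlead_nonzeroD:
  "b \<noteq> [] \<Longrightarrow> \<forall>y\<in>set (tl b). y > 0 \<Longrightarrow> seq_weight c (rlead b) \<noteq> 0 \<Longrightarrow>
    partial_sums_total b \<le> partial_sums_total c \<and>
    (partial_sums_total b = partial_sums_total c \<longrightarrow> b = c)"
proof (induction b arbitrary: c rule: rev_nonempty_induct)
  case (single y)
  then have "seq_weight c [] \<noteq> 0"
    using seq_weight_replicate_nonzeroD[of c y "[]"] by (simp add: rlead_single)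
  then obtain z where c: "c = [z]" by (auto split: if_splits simp: length_Suc_conv)
  then show ?case
    using seq_weight_nonzero_length[OF single(2)] by (simp add: rlead_single partial_sums_total_def)
next
  case (snoc y b)
  \<comment> \<open>The zeros after the last 1 contribute only factors, and that 1 uses up the last
    entry of \<open>c\<close>.\<close>
  have "seq_weight c (1 # rlead b) \<noteq> 0"
    using snoc.prems seq_weight_replicate_nonzeroD by (simp only: rlead_snoc[OF snoc.hyps(1)]) blast
  then obtain z d where c: "c = d @ [z]" and d: "seq_weight d (rlead b) \<noteq> 0"
    by (cases c rule: rev_cases) auto
  have "sum_list (b @ [y]) \<le> sum_list c"
    using seq_weight_nonzero_length[OF snoc.prems(2)] length_rlead[of "b @ [y]"] snoc.prems by auto
  moreover have "partial_sums_total b \<le> partial_sums_total d \<and>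
    (partial_sums_total b = partial_sums_total d \<longrightarrow> b = d)"
    using snoc.prems(1) snoc.hyps(1) by (intro snoc.IH[OF _ d]) auto
  ultimately show ?case unfolding c partial_sums_total_snoc by auto
qed

text \<open>Among the compositions of different multiplicity take \<open>b\<close> of largest total
  and test with \<open>rlead b\<close>. Any other \<open>c\<close> of nonzero weight has a larger
  total, hence equal multiplicities, so its terms cancel and the multiplicities of \<open>b\<close>
  agree, a contradiction.\<close>

lemma seq_weight_sums_determine_mset:
  assumes props: "\<And>b. b \<in># A + B \<Longrightarrow> b \<noteq> [] \<and> sum_list b = n \<and> (\<forall>y\<in>set (tl b). y > 0)"
    and eq: "\<And>s. length s = n \<Longrightarrow> (\<Sum>b\<in>#A. seq_weight b s) = (\<Sum>b\<in>#B. seq_weight b s)"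
  shows "A = B"
proof (rule ccontr)
  assume "A \<noteq> B"
  define U where "U = set_mset A \<union> set_mset B"
  define D where "D = {b \<in> U. count A b \<noteq> count B b}"
  have fin: "finite U" "finite D" by (auto simp: U_def D_def)
  have "D \<noteq> {}"
  proof
    assume D: "D = {}"
    have "count A b = count B b" for b
    proof (cases "b \<in> U")
      case True
      then show ?thesis using D by (auto simp: D_def)
    next
      case False
      then show ?thesis by (simp add: U_def not_in_iff)
    qed
    then show False using \<open>A \<noteq> B\<close> multiset_eqI by blast
  qed
  then have "Max (partial_sums_total ` D) \<in> partial_sums_total ` D" using fin by simp
  then obtain b where b: "b \<in> D" "partial_sums_total b = Max (partial_sums_total ` D)" by auto
  have bp: "b \<noteq> []" "sum_list b = n" "\<forall>y\<in>set (tl b). y > 0"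
    using b(1) props[of b] by (auto simp: D_def U_def)
  have bU: "b \<in> U" using b by (simp add: D_def)
  have rest: "count A c * seq_weight c (rlead b) = count B c * seq_weight c (rlead b)"
    if c: "c \<in> U - {b}" for c
  proof (cases "seq_weight c (rlead b) = 0")
    case False
    then have "partial_sums_total b < partial_sums_total c"
      using seq_weight_rlead_nonzeroD[OF bp(1,3) False] c by auto
    moreover have "partial_sums_total c \<le> partial_sums_total b" if "c \<in> D"
      unfolding b(2) using fin that by (intro Max_ge) auto
    ultimately have "c \<notin> D" by auto
    then show ?thesis using c by (auto simp: D_def)
  qed simp
  have "(\<Sum>c\<in>U. count A c * seq_weight c (rlead b)) = (\<Sum>c\<in>U. count B c * seq_weight c (rlead b))"
    using eq[of "rlead b"] length_rlead[OF bp(1,3)] bp(2) fin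
    by (simp add: sum_mset_eq_sum_count[of U] U_def)
  then have "count A b * seq_weight b (rlead b) = count B b * seq_weight b (rlead b)"
    using rest by (simp add: sum.remove[OF fin(1) bU])
  then show False using seq_weight_rlead_pos[OF bp(1,3)] b(1) by (simp add: D_def)
qed

theorem G_invariant_eq_iff:
  assumes "matroid M" "matroid N"
  shows "(G_invariant M :: nat list \<Rightarrow>\<^sub>0 'k::field_char_0) = G_invariant N \<longleftrightarrow>
    catenary_mset M = catenary_mset N"
proof -
  interpret M: matroid M by fact
  interpret N: matroid N by fact
  show ?thesis
  proof
    assume eq: "(G_invariant M :: nat list \<Rightarrow>\<^sub>0 'k) = G_invariant N"
    obtain s where s: "Poly_Mapping.lookup (G_invariant M :: nat list \<Rightarrow>\<^sub>0 'k) (rev s) \<noteq> 0"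
      by (rule M.G_invariant_nonzero)
    have n: "card (ground M) = card (ground N)"
      using s M.lookup_G_invariant[of s, where 'k = 'k] N.lookup_G_invariant[of s, where 'k = 'k] eq
      by (auto split: if_splits)
    show "catenary_mset M = catenary_mset N"
    proof (rule seq_weight_sums_determine_mset)
      fix b assume "b \<in># catenary_mset M + catenary_mset N"
      then show "b \<noteq> [] \<and> sum_list b = card (ground M) \<and> (\<forall>y\<in>set (tl b). y > 0)"
        using M.catenary_mset_props[of b] N.catenary_mset_props[of b] n by auto
    next
      fix s :: "nat list" assume "length s = card (ground M)"
      \<comment> \<open>The coefficients are images of natural numbers, and \<open>of_nat\<close> is
        injective in characteristic zero.\<close>
      then show "(\<Sum>b\<in>#catenary_mset M. seq_weight b s) = (\<Sum>b\<in>#catenary_mset N. seq_weight b s)"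
        using M.lookup_G_invariant[of s, where 'k = 'k] N.lookup_G_invariant[of s, where 'k = 'k] eq n
        by (simp del: of_nat_sum_mset)
    qed
  next
    assume eq: "catenary_mset M = catenary_mset N"
    obtain b where "b \<in># catenary_mset M" using M.catenary_mset_nonempty by blast
    then have n: "card (ground M) = card (ground N)"
      using eq M.catenary_mset_props(2)[of b] N.catenary_mset_props(2)[of b] by auto
    show "(G_invariant M :: nat list \<Rightarrow>\<^sub>0 'k) = G_invariant N"
    proof (rule poly_mapping_eqI)
      fix s
      show "Poly_Mapping.lookup (G_invariant M :: nat list \<Rightarrow>\<^sub>0 'k) s = Poly_Mapping.lookup (G_invariant N) s"
        using M.lookup_G_invariant[of "rev s", where 'k = 'k]
          N.lookup_G_invariant[of "rev s", where 'k = 'k] eq n by simp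
    qed
  qed
qed

text \<open>Ranks of subsets of \<open>F\<close> determine its lower covers. Working below a flat
  serves both for the isomorphism from the base of a cone and for the projection of a flat from the
  apex.\<close>

lemma flag_comps_bij:
  assumes "matroid M" "matroid N" "is_flat M F" "is_flat N F'" "bij_betw f F F'"
    and "\<And>X. X \<subseteq> F \<Longrightarrow> rk N (f ` X) = rk M X"
  shows "flag_comps M k F = flag_comps N k F'"
  using assms(3-6)
proof (induction k arbitrary: F F')
  case 0
  then show ?case by (simp add: bij_betw_same_card)
next
  case (Suc k)
  interpret M: matroid M by fact
  interpret N: matroid N by fact
  note flat = Suc.prems(1,2) and rk = Suc.prems(4)
  have inj: "inj_on f F" and F': "F' = f ` F" using Suc.prems(3) by (auto simp: bij_betw_def)
  have flat_iff: "is_flat N (f ` G) \<longleftrightarrow> is_flat M G" if "G \<subseteq> F" for G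
  proof -
    have *: "f ` F - f ` G = f ` (F - G)" using inj that by (simp add: inj_on_image_set_diff)
    have "rk N (insert (f x) (f ` G)) = rk M (insert x G)" if "x \<in> F" for x
      using rk[of "insert x G"] that \<open>G \<subseteq> F\<close> by simp
    then show ?thesis
      using M.flat_subset_iff_rk[OF flat(1) that] N.flat_subset_iff_rk[OF flat(2), of "f ` G"] that rk[OF that]
      by (auto simp: F' *)
  qed
  have covers: "lower_covers N F' = (`) f ` lower_covers M F"
  proof (intro equalityI subsetI)
    fix H assume H: "H \<in> lower_covers N F'"
    then obtain G where G: "G \<subseteq> F" "H = f ` G"
      unfolding lower_covers_def F' by (auto simp: subset_image_iff)
    then have "G \<in> lower_covers M F"
      using H flat_iff[of G] rk[of G] rk[of F] by (auto simp: lower_covers_def F')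
    then show "H \<in> (`) f ` lower_covers M F" using G by auto
  next
    fix H assume "H \<in> (`) f ` lower_covers M F"
    then obtain G where G: "G \<in> lower_covers M F" "H = f ` G" by auto
    then show "H \<in> lower_covers N F'"
      using flat_iff[of G] rk[of G] rk[of F] by (auto simp: lower_covers_def F')
  qed
  have "inj_on ((`) f) (lower_covers M F)"
    using inj_on_image_eq_iff[OF inj] by (auto simp: inj_on_def lower_covers_def)
  then have "flag_comps N (Suc k) F' = (\<Sum>G\<in>lower_covers M F.
      image_mset (\<lambda>c. c @ [card (F' - f ` G)]) (flag_comps N k (f ` G)))"
    by (simp add: covers sum.reindex)
  also have "\<dots> = flag_comps M (Suc k) F"
    unfolding flag_comps.simps
  proof (rule sum.cong[OF refl])
    fix G assume "G \<in> lower_covers M F"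
    then have G: "G \<subseteq> F" "is_flat M G" by (auto simp: lower_covers_def)
    have "F' - f ` G = f ` (F - G)" using inj G by (simp add: F' inj_on_image_set_diff)
    then have "card (F' - f ` G) = card (F - G)"
      using inj by (simp add: card_image inj_on_subset)
    moreover have "flag_comps M k G = flag_comps N k (f ` G)"
      using G flat_iff[of G] rk inj by (intro Suc.IH) (auto simp: bij_betw_def inj_on_subset)
    ultimately show "image_mset (\<lambda>c. c @ [card (F' - f ` G)]) (flag_comps N k (f ` G)) =
        image_mset (\<lambda>c. c @ [card (F - G)]) (flag_comps M k G)" by simp
  qed
  finally show ?case by simp
qed

section \<open>Cones\<close>

text \<open>The compositions of the flags of a cone that lie over a flag of composition \<open>b\<close> of the
  base: the apex enters in step \<open>k + 1\<close>, and there are \<open>q ^ k\<close> choices for the flat of rank \<open>k\<close>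
  that avoids the apex.\<close>

definition cone_comps :: "nat \<Rightarrow> nat list \<Rightarrow> nat list multiset" where
  "cone_comps q b = (\<Sum>k<length b. replicate_mset (q ^ k)
     (take (Suc k) b @ [q * sum_list (take (Suc k) b) + 1 - sum_list (take (Suc k) b)] @
      map ((*) q) (drop (Suc k) b)))"

lemma cone_comps_Nil [simp]: "cone_comps q [] = {#}"
  by (simp add: cone_comps_def)

text \<open>In the summands for smaller \<open>k\<close> the apex is present before the last step,
  which therefore adds \<open>q * y\<close> points; in the new summand the apex enters last.\<close>

lemma cone_comps_snoc:
  "cone_comps q (b @ [y]) = image_mset (\<lambda>c. c @ [q * y]) (cone_comps q b) +
    replicate_mset (q ^ length b) ((b @ [y]) @ [q * sum_list (b @ [y]) + 1 - sum_list (b @ [y])])"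
  by (simp add: cone_comps_def image_mset_sum)

lemma sum_constant_mset: "finite C \<Longrightarrow> (\<Sum>x\<in>C. A) = repeat_mset (card C) A"
  by (induction C rule: finite_induct) auto

lemma sum_mset_replicate_mset:
  "(\<Sum>b\<in>#A. replicate_mset m (f b)) = repeat_mset m (image_mset f A)"
  by (induction A) auto

lemma image_mset_sum_mset: "image_mset f (\<Sum>b\<in>#A. g b) = (\<Sum>b\<in>#A. image_mset f (g b))"
  by (induction A) auto

text \<open>\<open>M\<close> is the cone itself, \<open>E\<close> its base. The assumptions collect
  the geometry that the count uses. Of these, \<open>line_meets\<close> stands for modularity: the
  line from \<open>a\<close> to \<open>e\<close> meets the closure of \<open>F\<close> once
  \<open>F\<close> and \<open>a\<close> span \<open>e\<close>.\<close>

locale cone_matroid = matroid M for M :: "'a set_system" +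
  fixes E :: "'a set" and a :: 'a and q :: nat
  assumes apex: "a \<in> ground M"
    and base: "E \<subseteq> ground M"
    and apex_notin_cl: "a \<notin> cl M E"
    and cl_single: "x \<in> ground M \<Longrightarrow> cl M {x} = {x}"
    and on_line: "x \<in> ground M \<Longrightarrow> x \<noteq> a \<Longrightarrow> \<exists>e \<in> E. x \<in> cl M {a, e}"
    and card_line: "e \<in> E \<Longrightarrow> card (cl M {a, e}) = Suc q"
    and line_meets: "F \<subseteq> ground M \<Longrightarrow> e \<in> E \<Longrightarrow> e \<in> cl M (insert a F) \<Longrightarrow>
      cl M F \<inter> cl M {a, e} \<noteq> {}"
begin

lemma apex_notin_cl_subset: "X \<subseteq> E \<Longrightarrow> a \<notin> cl M X"
  using apex_notin_cl cl_mono by blast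

text \<open>A point \<open>x\<close> of the closure lies on the line from \<open>a\<close> to some
  \<open>e\<close> in \<open>E\<close>. If \<open>x\<close> differed from \<open>e\<close>, the two
  would span that line and put \<open>a\<close> into the closure of \<open>E\<close>.\<close>

lemma flat_base: "is_flat M E"
proof (rule is_flatI[OF base], rule subsetI)
  fix x assume x: "x \<in> cl M E"
  then have xg: "x \<in> ground M" "x \<noteq> a" using cl_subset_ground apex_notin_cl by auto
  then obtain e where e: "e \<in> E" "x \<in> cl M {a, e}" using on_line by blast
  have "x = e"
  proof (rule ccontr)
    assume "x \<noteq> e"
    then have "x \<notin> cl M {e}" using cl_single[of e] e base by auto
    then have "a \<in> cl M {x, e}" using cl_exchange[OF apex e(2)] by simp
    moreover have "cl M {x, e} \<subseteq> cl M (cl M E)"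
      using x e cl_extensive[OF base] by (intro cl_mono) auto
    ultimately show False using apex_notin_cl cl_cl[OF base] by auto
  qed
  then show "x \<in> E" using e by simp
qed

lemma line_eq:
  assumes "e \<in> ground M" "x \<in> cl M {a, e}" "x \<noteq> a"
  shows "cl M {a, x} = cl M {a, e}"
proof -
  have x: "x \<in> ground M" using assms cl_subset_ground by auto
  have "e \<in> cl M {x, a}"
    using cl_exchange[OF assms(1), of x "{a}"] assms cl_single[OF apex]
    by (simp add: insert_commute)
  moreover have "a \<in> cl M {a, x}" "a \<in> cl M {a, e}"
    using assms(1) x apex cl_extensive[of "{a, x}"] cl_extensive[of "{a, e}"] by auto
  ultimately show ?thesis
    using assms x apex by (intro equalityI; subst cl_subset_iff) (simp_all add: insert_commute)
qed

lemma line_unique: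
  assumes "e \<in> E" "e' \<in> E" "x \<in> cl M {a, e}" "x \<in> cl M {a, e'}" "x \<noteq> a"
  shows "e = e'"
proof (rule ccontr)
  assume "e \<noteq> e'"
  have "cl M {a, e} = cl M {a, e'}"
    using line_eq[of e x] line_eq[of e' x] assms base by auto
  then have "e' \<in> cl M {a, e}" using cl_extensive[of "{a, e'}"] assms base apex by auto
  moreover have "e' \<notin> cl M {e}" using cl_single[of e] \<open>e \<noteq> e'\<close> assms base by auto
  ultimately have "a \<in> cl M {e', e}" using cl_exchange[OF apex] by simp
  then show False using apex_notin_cl_subset[of "{e', e}"] assms by auto
qed

section \<open>Projection from the apex\<close>

definition proj :: "'a \<Rightarrow> 'a" where
  "proj x = (SOME e. e \<in> E \<and> x \<in> cl M {a, e})"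

text \<open>The apex is excluded because it lies on every line to the base, so there the choice is
  arbitrary.\<close>

lemma proj:
  assumes "x \<in> ground M" "x \<noteq> a"
  shows "proj x \<in> E" "x \<in> cl M {a, proj x}" "cl M {a, proj x} = cl M {a, x}"
proof -
  have "proj x \<in> E \<and> x \<in> cl M {a, proj x}"
    using someI_ex[of "\<lambda>e. e \<in> E \<and> x \<in> cl M {a, e}"] on_line[OF assms] unfolding proj_def by blast
  then show "proj x \<in> E" "x \<in> cl M {a, proj x}" by auto
  then show "cl M {a, proj x} = cl M {a, x}" using line_eq[of "proj x" x] base assms by auto
qed

lemma proj_eqI: "e \<in> E \<Longrightarrow> x \<in> cl M {a, e} \<Longrightarrow> x \<noteq> a \<Longrightarrow> proj x = e"
  using line_unique proj[of x] cl_subset_ground by blast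

lemma proj_in_line: "x \<in> ground M \<Longrightarrow> x \<noteq> a \<Longrightarrow> proj x \<in> cl M {a, x}"
  using proj[of x] cl_extensive[of "{a, proj x}"] base apex by auto

lemma cl_insert_apex_proj:
  assumes X: "X \<subseteq> ground M" "a \<notin> X"
  shows "cl M (insert a (proj ` X)) = cl M (insert a X)"
proof -
  have P: "proj ` X \<subseteq> ground M" using proj(1) X base by blast
  have 1: "proj x \<in> cl M (insert a X)" if "x \<in> X" for x
    using proj_in_line[of x] X that cl_mono[of "{a, x}" "insert a X"] by auto
  have 2: "x \<in> cl M (insert a (proj ` X))" if "x \<in> X" for x
    using proj(2)[of x] X that cl_mono[of "{a, proj x}" "insert a (proj ` X)"] by auto
  show ?thesis
  proof (rule equalityI)
    show "cl M (insert a (proj ` X)) \<subseteq> cl M (insert a X)"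
      using 1 P X apex cl_extensive[of "insert a X"] by (subst cl_subset_iff) auto
    show "cl M (insert a X) \<subseteq> cl M (insert a (proj ` X))"
      using 2 P X apex cl_extensive[of "insert a (proj ` X)"] by (subst cl_subset_iff) auto
  qed
qed

text \<open>Beside \<open>a\<close> each point can be replaced by its projection, and
  \<open>a\<close> adds one to the rank of any subset of the base.\<close>

lemma rk_insert_apex_proj:
  assumes "X \<subseteq> ground M" "a \<notin> X"
  shows "rk M (insert a X) = Suc (rk M (proj ` X))"
proof -
  have P: "proj ` X \<subseteq> E" using proj(1) assms by blast
  then have "rk M (insert a (proj ` X)) = Suc (rk M (proj ` X))"
    using apex apex_notin_cl_subset by (intro rk_insert_notin_cl) auto
  moreover have "rk M (insert a (proj ` X)) = rk M (insert a X)"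
    using cl_insert_apex_proj[OF assms] rk_cl[of "insert a (proj ` X)"] rk_cl[of "insert a X"]
      P base apex assms by auto
  ultimately show ?thesis by simp
qed

text \<open>Together with \<open>a\<close> both sets span the same flat, and \<open>a\<close> adds
  one to the rank of each.\<close>

lemma rk_proj:
  assumes "X \<subseteq> ground M" "a \<notin> cl M X"
  shows "rk M (proj ` X) = rk M X"
proof -
  have "a \<notin> X" using cl_extensive[OF assms(1)] assms(2) by auto
  then show ?thesis
    using rk_insert_apex_proj[OF assms(1)] rk_insert_notin_cl[OF apex assms(2)] by simp
qed

text \<open>Two points of \<open>F\<close> with the same projection are collinear with
  \<open>a\<close>, so the flat would contain \<open>a\<close>.\<close>

lemma inj_on_proj:
  assumes F: "is_flat M F" "a \<notin> F"
  shows "inj_on proj F"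
proof (rule inj_onI, rule ccontr)
  fix x y assume xy: "x \<in> F" "y \<in> F" "proj x = proj y" "x \<noteq> y"
  then have g: "x \<in> ground M" "y \<in> ground M" "x \<noteq> a" "y \<noteq> a" using F by (auto simp: is_flat_def)
  then have "y \<in> cl M {a, x}" using proj(2)[of y] proj(3)[of x] xy by simp
  moreover have "y \<notin> cl M {x}" using cl_single g xy by auto
  ultimately have "a \<in> cl M {y, x}" using cl_exchange[OF apex] by simp
  then show False using cl_subset_flat[OF F(1), of "{y, x}"] F xy by auto
qed

lemma proj_flat:
  assumes F: "is_flat M F" "a \<notin> F"
  shows "proj ` F = cl M (insert a F) \<inter> E"
proof (intro equalityI subsetI)
  fix e assume "e \<in> proj ` F"
  then obtain x where x: "x \<in> F" "e = proj x" by auto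
  then have g: "x \<in> ground M" "x \<noteq> a" using F by (auto simp: is_flat_def)
  then show "e \<in> cl M (insert a F) \<inter> E"
    using proj_in_line[OF g] proj(1)[OF g] cl_mono[of "{a, x}" "insert a F"] x by auto
next
  fix e assume e: "e \<in> cl M (insert a F) \<inter> E"
  \<comment> \<open>The preimage of \<open>e\<close> is the point where its line through
    \<open>a\<close> meets \<open>F\<close>.\<close>
  then obtain x where "x \<in> F" "x \<in> cl M {a, e}"
    using line_meets[of F e] F by (auto simp: is_flat_def)
  then show "e \<in> proj ` F" using proj_eqI[of e x] F e by (intro image_eqI[of _ _ x]) auto
qed

lemma is_flat_proj: "is_flat M F \<Longrightarrow> a \<notin> F \<Longrightarrow> is_flat M (proj ` F)"
  using is_flat_Int[OF is_flat_cl flat_base, of "insert a F"] apex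
  by (auto simp: proj_flat is_flat_def)

lemma flag_comps_proj:
  assumes F: "is_flat M F" "a \<notin> F"
  shows "flag_comps M k F = flag_comps M k (proj ` F)"
proof (rule flag_comps_bij)
  fix X assume X: "X \<subseteq> F"
  then have "X \<subseteq> ground M" "a \<notin> cl M X"
    using F cl_subset_flat[OF F(1) X] by (auto simp: is_flat_def)
  then show "rk M (proj ` X) = rk M X" by (rule rk_proj)
qed (use matroid_axioms F is_flat_proj inj_on_proj in \<open>auto simp: bij_betw_def\<close>)

section \<open>Flats through the apex\<close>

definition cone :: "'a set \<Rightarrow> 'a set" where
  "cone Y = cl M (insert a Y)"

lemma is_flat_cone: "Y \<subseteq> ground M \<Longrightarrow> is_flat M (cone Y)"
  using apex by (simp add: cone_def is_flat_cl)

lemma subset_cone: "Y \<subseteq> ground M \<Longrightarrow> insert a Y \<subseteq> cone Y"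
  using apex cl_extensive[of "insert a Y"] by (simp add: cone_def)

lemma cone_mono: "Z \<subseteq> Y \<Longrightarrow> cone Z \<subseteq> cone Y"
  unfolding cone_def by (rule cl_mono) auto

lemma rk_cone: "Y \<subseteq> E \<Longrightarrow> rk M (cone Y) = Suc (rk M Y)"
  using rk_cl[of "insert a Y"] apex base rk_insert_notin_cl[OF apex apex_notin_cl_subset, of Y]
  by (auto simp: cone_def)

text \<open>A base point in the cone but outside \<open>Y\<close> could be exchanged with
  \<open>a\<close>, which would put \<open>a\<close> into the closure of \<open>E\<close>.\<close>

lemma cone_Int_base:
  assumes "is_flat M Y" "Y \<subseteq> E"
  shows "cone Y \<inter> E = Y"
proof
  show "cone Y \<inter> E \<subseteq> Y"
  proof (rule subsetI, rule ccontr)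
    fix e assume e: "e \<in> cone Y \<inter> E" "e \<notin> Y"
    then have "a \<in> cl M (insert e Y)"
      using assms(1) cl_exchange[OF apex, of e Y] by (simp add: cone_def is_flat_def)
    then show False using apex_notin_cl_subset[of "insert e Y"] e assms by auto
  qed
qed (use subset_cone assms base in auto)

lemma proj_in_cone:
  assumes "is_flat M Y" "Y \<subseteq> E" "x \<in> cone Y" "x \<noteq> a"
  shows "proj x \<in> Y"
proof -
  have Y: "Y \<subseteq> ground M" using assms base by auto
  have x: "x \<in> ground M" using assms cl_subset_ground by (auto simp: cone_def)
  have "cl M {a, x} \<subseteq> cone Y"
    using assms subset_cone[OF Y] by (intro cl_subset_flat is_flat_cone[OF Y]) auto
  then have "proj x \<in> cone Y \<inter> E" using proj_in_line[OF x assms(4)] proj(1)[OF x assms(4)] by auto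
  then show ?thesis using cone_Int_base assms by auto
qed

text \<open>With a point \<open>x\<close> other than \<open>a\<close> the flat contains the line
  through \<open>a\<close> and \<open>x\<close>, hence also \<open>proj x\<close>. So its base
  points and \<open>a\<close> generate it.\<close>

lemma cone_of_flat:
  assumes "is_flat M F" "a \<in> F"
  shows "cone (F \<inter> E) = F"
proof
  show "cone (F \<inter> E) \<subseteq> F"
    unfolding cone_def using assms by (intro cl_subset_flat) auto
  show "F \<subseteq> cone (F \<inter> E)"
  proof
    fix x assume x: "x \<in> F"
    show "x \<in> cone (F \<inter> E)"
    proof (cases "x = a")
      case True
      then show ?thesis using subset_cone[of "F \<inter> E"] base by auto
    next
      case False
      have xg: "x \<in> ground M" using assms x by (auto simp: is_flat_def)
      have "cl M {a, x} \<subseteq> F" using assms x by (intro cl_subset_flat) auto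
      then have "proj x \<in> F \<inter> E" using proj_in_line[OF xg False] proj(1)[OF xg False] by auto
      then have "cl M {a, proj x} \<subseteq> cone (F \<inter> E)" unfolding cone_def by (intro cl_mono) auto
      then show ?thesis using proj(2)[OF xg False] by auto
    qed
  qed
qed

text \<open>The lines from \<open>a\<close> to the points of \<open>Y\<close>, with \<open>a\<close>
  removed, partition the rest of the cone into blocks of size \<open>q\<close>.\<close>

lemma card_cone:
  assumes Y: "is_flat M Y" "Y \<subseteq> E"
  shows "card (cone Y) = q * card Y + 1"
proof -
  have fin: "finite Y" using Y flat_finite by auto
  have "cone Y - {a} = (\<Union>y\<in>Y. cl M {a, y} - {a})"
  proof (intro equalityI subsetI)
    fix x assume x: "x \<in> cone Y - {a}"
    then have "x \<in> ground M" using cl_subset_ground by (auto simp: cone_def)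
    then show "x \<in> (\<Union>y\<in>Y. cl M {a, y} - {a})" using proj(2)[of x] proj_in_cone[OF Y, of x] x by auto
  next
    fix x assume "x \<in> (\<Union>y\<in>Y. cl M {a, y} - {a})"
    then obtain y where "y \<in> Y" "x \<in> cl M {a, y}" "x \<noteq> a" by auto
    then show "x \<in> cone Y - {a}" using cl_mono[of "{a, y}" "insert a Y"] by (auto simp: cone_def)
  qed
  moreover have "card (\<Union>y\<in>Y. cl M {a, y} - {a}) = (\<Sum>y\<in>Y. card (cl M {a, y} - {a}))"
  proof (rule card_UN_disjoint[OF fin]; intro ballI impI)
    fix y z assume "y \<in> Y" "z \<in> Y" "y \<noteq> z"
    then show "(cl M {a, y} - {a}) \<inter> (cl M {a, z} - {a}) = {}"
      using line_unique[of y z] Y by auto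
  qed (simp add: finite_cl)
  moreover have "\<dots> = (\<Sum>y\<in>Y. q)"
  proof (rule sum.cong[OF refl])
    fix y assume "y \<in> Y"
    then have "a \<in> cl M {a, y}" using cl_extensive[of "{a, y}"] apex base Y by auto
    then show "card (cl M {a, y} - {a}) = q" using card_line[of y] \<open>y \<in> Y\<close> Y by (auto simp: finite_cl)
  qed
  ultimately have "card (cone Y - {a}) = q * card Y" by simp
  moreover have "a \<in> cone Y" "finite (cone Y)" using subset_cone[of Y] Y base finite_cl by (auto simp: cone_def)
  ultimately show ?thesis using card_Suc_Diff1[of "cone Y" a] by simp
qed

section \<open>Flats avoiding the apex\<close>

definition sections :: "'a set \<Rightarrow> 'a set set" where
  "sections Y = {G. is_flat M G \<and> G \<subseteq> cone Y \<and> rk M G = rk M Y \<and> a \<notin> G}"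

text \<open>For rank reasons \<open>G\<close> and \<open>a\<close> span the whole cone, and the
  projection of \<open>G\<close> is what this span cuts out of the base.\<close>

lemma proj_section:
  assumes Y: "is_flat M Y" "Y \<subseteq> E" and G: "G \<in> sections Y"
  shows "proj ` G = Y"
proof -
  have G': "is_flat M G" "G \<subseteq> cone Y" "rk M G = rk M Y" "a \<notin> G" using G by (auto simp: sections_def)
  have Yg: "Y \<subseteq> ground M" and Gg: "insert a G \<subseteq> ground M"
    using Y base G' apex by (auto simp: is_flat_def)
  have "rk M (insert a G) = Suc (rk M G)"
    using G' apex by (intro rk_insert_notin_cl) (auto simp: is_flat_def)
  then have "cl M (insert a G) = cl M (cone Y)"
    using G' rk_cone[OF Y(2)] subset_cone[OF Yg] is_flat_cone[OF Yg]
    by (intro cl_eq_if_rk_le) (auto simp: is_flat_def)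
  then have "cl M (insert a G) = cone Y" using is_flat_cone[OF Yg] by (simp add: is_flat_def)
  then show ?thesis using proj_flat[OF G'(1,4)] cone_Int_base[OF Y] by simp
qed

text \<open>A flat of the cone over \<open>Y\<close> that avoids the apex and projects onto \<open>Y\<close> is determined by the
  points in which it meets the lines from the apex to a basis of \<open>Y\<close>, and these are arbitrary.\<close>

lemma card_sections:
  assumes Y: "is_flat M Y" "Y \<subseteq> E"
  shows "card (sections Y) = q ^ rk M Y"
proof -
  obtain B where B: "B \<subseteq> Y" "indep M B" "card B = rk M Y" by (rule obtain_basis)
  have finB: "finite B" using finite_indep B by auto
  have Yg: "Y \<subseteq> ground M" using Y base by auto
  define S where "S = (\<Pi>\<^sub>E b\<in>B. cl M {a, b} - {a})"
  have gB: "g ` B \<subseteq> ground M" "a \<notin> g ` B" "\<And>b. b \<in> B \<Longrightarrow> proj (g b) = b" if "g \<in> S" for g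
    using that proj_eqI B Y cl_subset_ground by (fastforce simp: S_def PiE_iff)+
  have in_sections: "cl M (g ` B) \<in> sections Y" if g: "g \<in> S" for g
  proof -
    note gB = gB[OF g]
    \<comment> \<open>The chosen points project back to \<open>B\<close>, which fixes their rank
      with \<open>a\<close> added; the bound by \<open>card B\<close> then fixes it without
      \<open>a\<close>.\<close>
    have "proj ` g ` B = B" using gB(3) by (force simp: image_image)
    then have rk_a: "rk M (insert a (g ` B)) = Suc (rk M Y)"
      using rk_insert_apex_proj[OF gB(1,2)] rk_indep B by simp
    moreover have "rk M (g ` B) \<le> rk M Y"
      using rk_le_card[of "g ` B"] card_image_le[OF finB, of g] finB B by auto
    ultimately have rk: "rk M (g ` B) = rk M Y" using rk_insert_le[of a "g ` B"] by auto
    then have "a \<notin> cl M (g ` B)" using rk_a rk_insert_in_cl by auto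
    moreover have "cl M (g ` B) \<subseteq> cone Y"
    proof (rule cl_subset_flat[OF is_flat_cone[OF Yg]], rule image_subsetI)
      fix b assume b: "b \<in> B"
      then have "g b \<in> cl M {a, b}" using g by (auto simp: S_def PiE_iff)
      then show "g b \<in> cone Y" using cl_mono[of "{a, b}" "insert a Y"] b B by (auto simp: cone_def)
    qed
    ultimately show ?thesis using gB rk rk_cl is_flat_cl by (simp add: sections_def)
  qed
  have "bij_betw (\<lambda>g. cl M (g ` B)) S (sections Y)"
    unfolding bij_betw_def
  proof (intro conjI equalityI subsetI)
    show "inj_on (\<lambda>g. cl M (g ` B)) S"
    proof (rule inj_onI)
      fix g h assume gh: "g \<in> S" "h \<in> S" "cl M (g ` B) = cl M (h ` B)"
      have inj: "inj_on proj (cl M (g ` B))"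
        using in_sections[OF gh(1)] by (intro inj_on_proj) (auto simp: sections_def)
      show "g = h"
      proof (rule PiE_ext)
        show "g \<in> (\<Pi>\<^sub>E b\<in>B. cl M {a, b} - {a})" "h \<in> (\<Pi>\<^sub>E b\<in>B. cl M {a, b} - {a})"
          using gh by (auto simp: S_def)
        fix b assume b: "b \<in> B"
        have "g b \<in> cl M (g ` B)" "h b \<in> cl M (g ` B)"
          using b gh cl_extensive[OF gB(1)[OF gh(1)]] cl_extensive[OF gB(1)[OF gh(2)]] by auto
        \<comment> \<open>Both points lie in one flat avoiding \<open>a\<close>, where
          \<open>proj\<close> is injective, and both project to \<open>b\<close>.\<close>
        then show "g b = h b"
          using inj_onD[OF inj, of "g b" "h b"] gB(3)[OF gh(1) b] gB(3)[OF gh(2) b] by simp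
      qed
    qed
    fix G assume G: "G \<in> (\<lambda>g. cl M (g ` B)) ` S"
    then show "G \<in> sections Y" using in_sections by auto
  next
    fix G assume G: "G \<in> sections Y"
    then have G': "is_flat M G" "rk M G = rk M Y" "a \<notin> G" by (auto simp: sections_def)
    \<comment> \<open>The choice that yields \<open>G\<close> takes the point of \<open>G\<close>
      above each \<open>b\<close>.\<close>
    define g where "g = restrict (inv_into G proj) B"
    have g: "g b \<in> G" "proj (g b) = b" if "b \<in> B" for b
      using that B proj_section[OF Y G] inv_into_into[of b proj G] f_inv_into_f[of b proj G]
      by (auto simp: g_def)
    have gg: "g b \<in> ground M" "g b \<noteq> a" if "b \<in> B" for b
      using g(1)[OF that] G' by (auto simp: is_flat_def)
    have gS: "g \<in> S"
      unfolding S_def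
    proof (rule PiE_I)
      fix b assume b: "b \<in> B"
      then show "g b \<in> cl M {a, b} - {a}" using proj(2)[OF gg[OF b]] g(2)[OF b] gg[OF b] by auto
    qed (simp add: g_def)
    have "cl M (g ` B) = G"
      using g(1) in_sections[OF gS] G'
      by (intro flat_eqI cl_subset_flat) (auto simp: sections_def)
    then show "G \<in> (\<lambda>g. cl M (g ` B)) ` S" using gS by auto
  qed
  then have "card (sections Y) = card S" by (simp add: bij_betw_same_card)
  also have "\<dots> = (\<Prod>b\<in>B. card (cl M {a, b} - {a}))" unfolding S_def by (rule card_PiE[OF finB])
  also have "\<dots> = (\<Prod>b\<in>B. q)"
  proof (rule prod.cong[OF refl])
    fix b assume b: "b \<in> B"
    then have "a \<in> cl M {a, b}" using cl_extensive[of "{a, b}"] apex B Yg by auto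
    then show "card (cl M {a, b} - {a}) = q" using card_line[of b] b B Y by (auto simp: finite_cl)
  qed
  finally show ?thesis using B by simp
qed

text \<open>A flat covered by the cone has rank \<open>rk M Y\<close>. If it contains the apex, it
  is the cone over its trace on the base; otherwise it is a section by definition.\<close>

lemma lower_covers_cone:
  assumes Y: "is_flat M Y" "Y \<subseteq> E"
  shows "lower_covers M (cone Y) = cone ` lower_covers M Y \<union> sections Y"
proof (intro equalityI subsetI)
  fix G assume G: "G \<in> lower_covers M (cone Y)"
  then have G': "is_flat M G" "G \<subseteq> cone Y" "rk M G = rk M Y"
    using rk_cone[OF Y(2)] by (auto simp: lower_covers_def)
  show "G \<in> cone ` lower_covers M Y \<union> sections Y"
  proof (cases "a \<in> G")
    case True
    then have eq: "cone (G \<inter> E) = G" using G' cone_of_flat by auto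
    have "G \<inter> E \<in> lower_covers M Y"
      using G' cone_Int_base[OF Y] rk_cone[of "G \<inter> E"] eq is_flat_Int[OF G'(1) flat_base]
      by (auto simp: lower_covers_def)
    then show ?thesis using eq by (metis UnI1 imageI)
  next
    case False
    then show ?thesis using G' by (simp add: sections_def)
  qed
next
  fix G assume "G \<in> cone ` lower_covers M Y \<union> sections Y"
  then show "G \<in> lower_covers M (cone Y)"
  proof
    assume "G \<in> cone ` lower_covers M Y"
    then obtain Z where Z: "is_flat M Z" "Z \<subseteq> Y" "Suc (rk M Z) = rk M Y" "G = cone Z"
      by (auto simp: lower_covers_def)
    moreover have "cone Z \<subseteq> cone Y" using Z by (intro cone_mono)
    ultimately show ?thesis
      using rk_cone[of Z] rk_cone[of Y] Y base is_flat_cone[of Z] by (auto simp: lower_covers_def)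
  next
    assume "G \<in> sections Y"
    then show ?thesis using rk_cone[of Y] Y by (auto simp: lower_covers_def sections_def)
  qed
qed

section \<open>Counting the flags of a cone\<close>

lemma finite_sections: "finite (sections Y)"
  by (rule finite_subset[of _ "Pow (ground M)"])
     (auto simp: sections_def is_flat_def finite_ground)

text \<open>The flat before the last is either a smaller cone, of size
  \<open>q * card Z + 1\<close>, or a section, which by projection has the size and the flag
  compositions of \<open>Y\<close>.\<close>

lemma flag_comps_cone_Suc:
  assumes Y: "is_flat M Y" "Y \<subseteq> E"
  shows "flag_comps M (Suc k) (cone Y) =
    (\<Sum>Z\<in>lower_covers M Y. image_mset (\<lambda>c. c @ [q * card (Y - Z)]) (flag_comps M k (cone Z))) +
    repeat_mset (q ^ rk M Y)
      (image_mset (\<lambda>c. c @ [q * card Y + 1 - card Y]) (flag_comps M k Y))"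
proof -
  let ?h = "\<lambda>G. image_mset (\<lambda>c. c @ [card (cone Y - G)]) (flag_comps M k G)"
  have Yg: "Y \<subseteq> ground M" using Y base by auto
  have finY: "finite Y" using Y flat_finite by auto
  have "a \<in> cone Z" if "Z \<in> lower_covers M Y" for Z
    using that subset_cone[of Z] by (auto simp: lower_covers_def is_flat_def)
  then have disj: "cone ` lower_covers M Y \<inter> sections Y = {}" by (auto simp: sections_def)
  have inj: "inj_on cone (lower_covers M Y)"
  proof (rule inj_onI)
    fix Z Z' assume "Z \<in> lower_covers M Y" "Z' \<in> lower_covers M Y" "cone Z = cone Z'"
    then show "Z = Z'" using cone_Int_base[of Z] cone_Int_base[of Z'] Y
      by (auto simp: lower_covers_def)
  qed
  have "flag_comps M (Suc k) (cone Y) =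
    (\<Sum>G\<in>cone ` lower_covers M Y. ?h G) + (\<Sum>G\<in>sections Y. ?h G)"
    unfolding flag_comps.simps lower_covers_cone[OF Y]
    using disj finite_lower_covers finite_sections by (intro sum.union_disjoint) auto
  also have "(\<Sum>G\<in>cone ` lower_covers M Y. ?h G) = (\<Sum>Z\<in>lower_covers M Y. ?h (cone Z))"
    using inj by (simp add: sum.reindex)
  also have "\<dots> = (\<Sum>Z\<in>lower_covers M Y.
      image_mset (\<lambda>c. c @ [q * card (Y - Z)]) (flag_comps M k (cone Z)))"
  proof (rule sum.cong[OF refl])
    fix Z assume "Z \<in> lower_covers M Y"
    then have Z: "is_flat M Z" "Z \<subseteq> Y" by (auto simp: lower_covers_def)
    have "cone Z \<subseteq> cone Y" using Z by (intro cone_mono)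
    then have "card (cone Y - cone Z) = card (cone Y) - card (cone Z)"
      by (intro card_Diff_subset) (auto simp: cone_def finite_cl)
    also have "\<dots> = q * card (Y - Z)"
      using card_cone[OF Y] card_cone[of Z] Z Y finite_subset[OF Z(2) finY]
      by (simp add: card_Diff_subset diff_mult_distrib2)
    finally show "?h (cone Z) = image_mset (\<lambda>c. c @ [q * card (Y - Z)]) (flag_comps M k (cone Z))"
      by simp
  qed
  also have "(\<Sum>G\<in>sections Y. ?h G) =
    (\<Sum>G\<in>sections Y. image_mset (\<lambda>c. c @ [q * card Y + 1 - card Y]) (flag_comps M k Y))"
  proof (rule sum.cong[OF refl])
    fix G assume G: "G \<in> sections Y"
    then have G': "is_flat M G" "G \<subseteq> cone Y" "a \<notin> G" by (auto simp: sections_def)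
    have "card G = card Y"
      using card_image[OF inj_on_proj[OF G'(1,3)]] proj_section[OF Y G] by simp
    then have "card (cone Y - G) = q * card Y + 1 - card Y"
      using card_cone[OF Y] G' flat_finite by (simp add: card_Diff_subset)
    then show "?h G = image_mset (\<lambda>c. c @ [q * card Y + 1 - card Y]) (flag_comps M k Y)"
      using flag_comps_proj[OF G'(1,3), of k] proj_section[OF Y G] by simp
  qed
  also have "\<dots> = repeat_mset (q ^ rk M Y)
      (image_mset (\<lambda>c. c @ [q * card Y + 1 - card Y]) (flag_comps M k Y))"
    using card_sections[OF Y] finite_sections by (simp add: sum_constant_mset)
  finally show ?thesis .
qed

text \<open>The sections account for the apex entering last and the smaller cones for all earlier
  entries, which is the split in \<open>cone_comps_snoc\<close>.\<close>

lemma flag_comps_cone: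
  "is_flat M Y \<Longrightarrow> Y \<subseteq> E \<Longrightarrow> rk M Y = k \<Longrightarrow>
    flag_comps M (Suc k) (cone Y) = (\<Sum>b\<in>#flag_comps M k Y. cone_comps q b)"
proof (induction k arbitrary: Y)
  case 0
  then have "lower_covers M Y = {}" by (auto simp: lower_covers_def)
  then show ?case
    using flag_comps_cone_Suc[OF 0(1,2), of 0] cone_comps_snoc[of q "[]" "card Y"] 0(3) by simp
next
  case (Suc k)
  let ?n = "card Y" and ?A = "flag_comps M (Suc k) Y"
  have "(\<Sum>b\<in>#?A. cone_comps q b) =
    (\<Sum>b\<in>#?A. image_mset (\<lambda>c. c @ [q * last b]) (cone_comps q (butlast b)) +
      replicate_mset (q ^ Suc k) (b @ [q * ?n + 1 - ?n]))"
  proof (intro arg_cong[where f = sum_mset] image_mset_cong)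
    fix b assume "b \<in># ?A"
    then have b: "length b = Suc (Suc k)" "sum_list b = ?n"
      using flag_comps_props[OF Suc.prems(1,3)] by auto
    then obtain c y where c: "b = c @ [y]" by (cases b rule: rev_cases) auto
    then show "cone_comps q b = image_mset (\<lambda>c. c @ [q * last b]) (cone_comps q (butlast b)) +
      replicate_mset (q ^ Suc k) (b @ [q * ?n + 1 - ?n])"
      using b by (simp add: cone_comps_snoc)
  qed
  also have "\<dots> = (\<Sum>b\<in>#?A. image_mset (\<lambda>c. c @ [q * last b]) (cone_comps q (butlast b))) +
      repeat_mset (q ^ Suc k) (image_mset (\<lambda>b. b @ [q * ?n + 1 - ?n]) ?A)"
    unfolding sum_mset.distrib sum_mset_replicate_mset ..
  also have "(\<Sum>b\<in>#?A. image_mset (\<lambda>c. c @ [q * last b]) (cone_comps q (butlast b))) =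
    (\<Sum>Z\<in>lower_covers M Y. \<Sum>b\<in>#flag_comps M k Z.
      image_mset (\<lambda>c. c @ [q * card (Y - Z)]) (cone_comps q b))"
    by (simp add: sum_mset_image_sum image_mset.compositionality comp_def)
  also have "\<dots> = (\<Sum>Z\<in>lower_covers M Y.
      image_mset (\<lambda>c. c @ [q * card (Y - Z)]) (flag_comps M (Suc k) (cone Z)))"
  proof (rule sum.cong[OF refl])
    fix Z assume "Z \<in> lower_covers M Y"
    then have "flag_comps M (Suc k) (cone Z) = (\<Sum>b\<in>#flag_comps M k Z. cone_comps q b)"
      using Suc.prems by (intro Suc.IH) (auto simp: lower_covers_def)
    then show "(\<Sum>b\<in>#flag_comps M k Z. image_mset (\<lambda>c. c @ [q * card (Y - Z)]) (cone_comps q b)) =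
      image_mset (\<lambda>c. c @ [q * card (Y - Z)]) (flag_comps M (Suc k) (cone Z))"
      by (simp only: image_mset_sum_mset)
  qed
  finally show ?case
    unfolding flag_comps_cone_Suc[OF Suc.prems(1,2)] Suc.prems(3) by simp
qed

lemma cone_base: "cone E = ground M"
  using cone_of_flat[OF is_flat_ground apex] base by (simp add: Int_absorb1)

theorem catenary_mset_cone:
  "catenary_mset M = (\<Sum>b\<in>#flag_comps M (rk M E) E. cone_comps q b)"
  using flag_comps_cone[OF flat_base order_refl refl] rk_cone[OF order_refl]
  by (simp add: cone_base catenary_mset_def)

end

section \<open>Projective geometries\<close>

lemma finite_coord_space: "finite (coord_space n :: (nat \<Rightarrow> 'f::{field,finite}) set)"
  using finite_set_of_finite_funs[of "{..<n}" "UNIV :: 'f set" 0]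
  by (rule finite_subset[rotated]) (auto simp: coord_space_def)

lemma subspace_coord_space: "fvec.subspace (coord_space n)"
  by (auto simp: fvec.subspace_def coord_space_def fscale_def)

lemma finite_PG_points: "finite (PG_points r :: 'f::{field,finite} point set)"
  by (rule finite_subset[of _ "Pow (coord_space (Suc r))"])
     (auto simp: PG_points_def finite_coord_space)

lemma span_single_eq:
  assumes "v \<noteq> 0" "v \<in> fvec.span {w}"
  shows "fvec.span {v} = fvec.span {w}"
proof
  show "fvec.span {v} \<subseteq> fvec.span {w}"
    using assms(2) by (intro fvec.span_minimal fvec.subspace_span) auto
  obtain c where c: "v = fscale c w" using assms(2) by (auto simp: fvec.span_singleton)
  then have "c \<noteq> 0" using assms(1) by auto
  then have "w = fscale (inverse c) v" by (simp add: c)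
  then have "w \<in> fvec.span {v}" by (auto simp: fvec.span_singleton)
  then show "fvec.span {w} \<subseteq> fvec.span {v}"
    by (intro fvec.span_minimal fvec.subspace_span) auto
qed

lemma span_single_in_PG_points:
  assumes "v \<noteq> 0" "v \<in> coord_space (Suc r)"
  shows "fvec.span {v} \<in> PG_points r"
proof -
  have "fvec.dim (fvec.span {v}) = 1"
    using assms(1) by (subst fvec.dim_span_eq_card_independent) auto
  moreover have "fvec.span {v} \<subseteq> coord_space (Suc r)"
    using assms(2) subspace_coord_space by (intro fvec.span_minimal) auto
  ultimately show ?thesis by (simp add: PG_points_def)
qed

text \<open>One nonzero vector chosen in each point turns rank and closure in \<open>PG r\<close>
  into linear algebra.\<close>

definition rep :: "'f::field point \<Rightarrow> nat \<Rightarrow> 'f" where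
  "rep p = (SOME v. v \<noteq> 0 \<and> p = fvec.span {v})"

lemma rep:
  assumes "p \<in> PG_points r"
  shows "rep p \<noteq> 0" "fvec.span {rep p} = p"
proof -
  obtain B where B: "B \<subseteq> p" "fvec.independent B" "p \<subseteq> fvec.span B" "card B = fvec.dim p"
    using fvec.basis_exists by blast
  then obtain v where v: "B = {v}" using assms by (auto simp: PG_points_def card_1_singleton_iff)
  have "v \<noteq> 0 \<and> p = fvec.span {v}"
    using B assms fvec.span_minimal[of B p] by (auto simp: v PG_points_def)
  then have "rep p \<noteq> 0 \<and> p = fvec.span {rep p}"
    unfolding rep_def using someI[of "\<lambda>v. v \<noteq> 0 \<and> p = fvec.span {v}" v] by blast
  then show "rep p \<noteq> 0" "fvec.span {rep p} = p" by auto
qed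

lemma rep_in: "p \<in> PG_points r \<Longrightarrow> rep p \<in> p"
  using rep(2)[of p r] fvec.span_base[of "rep p" "{rep p}"] by auto

lemma rep_in_coord_space: "p \<in> PG_points r \<Longrightarrow> rep p \<in> coord_space (Suc r)"
  using rep_in[of p r] by (auto simp: PG_points_def)

lemma inj_on_rep: "inj_on rep (PG_points r)"
  by (rule inj_onI) (metis rep(2))

lemma span_Union_points:
  assumes "I \<subseteq> PG_points r"
  shows "fvec.span (\<Union>I) = fvec.span (rep ` I)"
proof
  have "p \<subseteq> fvec.span (rep ` I)" if "p \<in> I" for p
    using rep(2)[of p r] that assms fvec.span_mono[of "{rep p}" "rep ` I"] by auto
  then show "fvec.span (\<Union>I) \<subseteq> fvec.span (rep ` I)"
    by (intro fvec.span_minimal fvec.subspace_span) auto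
  show "fvec.span (rep ` I) \<subseteq> fvec.span (\<Union>I)"
    using rep_in assms by (intro fvec.span_mono) blast
qed

text \<open>A finite set of vectors is independent exactly if its span has dimension equal to its
  size. As \<open>rep\<close> is injective, points and vectors are equally many.\<close>

lemma indep_PG_iff:
  "indep (PG r :: 'f::{field,finite} point set_system) I \<longleftrightarrow>
    I \<subseteq> PG_points r \<and> fvec.independent (rep ` I)"
proof (cases "I \<subseteq> PG_points r")
  case True
  then have fin: "finite I" using finite_PG_points finite_subset by blast
  have card: "card (rep ` I) = card I" by (rule card_image[OF inj_on_subset[OF inj_on_rep True]])
  have "fvec.dim (fvec.span (rep ` I)) = card I \<longleftrightarrow> fvec.independent (rep ` I)"
  proof
    assume dim: "fvec.dim (fvec.span (rep ` I)) = card I"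
    obtain B where B: "B \<subseteq> rep ` I" "fvec.independent B" "rep ` I \<subseteq> fvec.span B"
      using fvec.maximal_independent_subset by blast
    then have "card B = card (rep ` I)" using fvec.basis_card_eq_dim[of B] dim card by simp
    then have "B = rep ` I" using B fin by (intro card_subset_eq) auto
    then show "fvec.independent (rep ` I)" using B by simp
  next
    assume "fvec.independent (rep ` I)"
    then show "fvec.dim (fvec.span (rep ` I)) = card I"
      using fvec.dim_span_eq_card_independent[of "rep ` I"] card by simp
  qed
  then show ?thesis
    using True by (simp only: PG_def set_system.simps span_Union_points[OF True] simp_thms)
qed (simp add: PG_def)

lemma ground_PG [simp]: "ground (PG r) = PG_points r"
  by (simp add: PG_def)

lemma matroid_PG: "matroid (PG r :: 'f::{field,finite} point set_system)"
proof
  fix I J :: "'f point set"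
  assume I: "indep (PG r) I" and J: "indep (PG r) J" and "card I < card J"
  have sub: "I \<subseteq> PG_points r" "J \<subseteq> PG_points r"
    and ind: "fvec.independent (rep ` I)" "fvec.independent (rep ` J)"
    using I J by (auto simp: indep_PG_iff)
  have card: "card (rep ` I) = card I" "card (rep ` J) = card J"
    using card_image[OF inj_on_subset[OF inj_on_rep sub(1)]]
      card_image[OF inj_on_subset[OF inj_on_rep sub(2)]] by auto
  have "finite (rep ` I)" using sub finite_PG_points finite_subset by blast
  then have "\<not> rep ` J \<subseteq> fvec.span (rep ` I)"
    using fvec.independent_span_bound[OF _ ind(2), of "rep ` I"] card \<open>card I < card J\<close> by auto
  then obtain y where y: "y \<in> J" "rep y \<notin> fvec.span (rep ` I)" by auto
  then have "y \<notin> I" using fvec.span_base[of "rep y" "rep ` I"] by blast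
  moreover have "fvec.independent (rep ` insert y I)"
    using ind(1) y by (simp add: fvec.independent_insert)
  ultimately show "\<exists>y \<in> J - I. indep (PG r) (insert y I)"
    using y sub by (intro bexI[of _ y]) (auto simp: indep_PG_iff)
next
  fix I J :: "'f point set" assume "indep (PG r) I" "J \<subseteq> I"
  then show "indep (PG r) J"
    using fvec.independent_mono[of "rep ` I" "rep ` J"] by (auto simp: indep_PG_iff)
qed (auto simp: indep_PG_iff finite_PG_points fvec.independent_empty)

lemma rk_PG:
  fixes I :: "'f::{field,finite} point set"
  assumes X: "X \<subseteq> PG_points r" and I: "I \<subseteq> X" "fvec.independent (rep ` I)"
    and span: "rep ` X \<subseteq> fvec.span (rep ` I)"
  shows "rk (PG r) X = card I"
proof (rule matroid.rk_eqI[OF matroid_PG])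
  fix J assume "indep (PG r) J" "J \<subseteq> X"
  then have J: "fvec.independent (rep ` J)" "J \<subseteq> PG_points r" "rep ` J \<subseteq> fvec.span (rep ` I)"
    using span by (auto simp: indep_PG_iff)
  have "finite (rep ` I)" using I X finite_PG_points by (meson finite_imageI finite_subset)
  then have "card (rep ` J) \<le> card (rep ` I)" using fvec.independent_span_bound J by blast
  then show "card J \<le> card I"
    using card_image[OF inj_on_subset[OF inj_on_rep J(2)]]
      card_image[OF inj_on_subset[OF inj_on_rep, of I r]] I X by auto
qed (use X I in \<open>auto simp: indep_PG_iff\<close>)

text \<open>A basis of the vectors of \<open>X\<close> comes from a set \<open>I\<close> of points.
  A vector in the span keeps the rank at \<open>card I\<close>; any other extends \<open>I\<close>
  to a larger independent set.\<close>

lemma cl_PG: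
  fixes X :: "'f::{field,finite} point set"
  assumes X: "X \<subseteq> PG_points r"
  shows "cl (PG r) X = {p \<in> PG_points r. rep p \<in> fvec.span (rep ` X)}"
proof -
  interpret matroid "PG r :: 'f point set_system" by (rule matroid_PG)
  obtain B where B: "B \<subseteq> rep ` X" "fvec.independent B" "rep ` X \<subseteq> fvec.span B"
    using fvec.maximal_independent_subset by blast
  then obtain I where I: "I \<subseteq> X" "B = rep ` I" by (meson subset_imageE)
  have spanI: "fvec.span (rep ` X) = fvec.span (rep ` I)"
    using B I fvec.span_mono[of "rep ` I" "rep ` X"] fvec.span_minimal[of "rep ` X" "fvec.span (rep ` I)"]
    by (auto simp: fvec.subspace_span)
  have rkX: "rk (PG r) X = card I" using X I B by (intro rk_PG) auto
  have finI: "finite I" using I X finite_PG_points by (meson finite_subset)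
  have "rk (PG r) (insert p X) = rk (PG r) X \<longleftrightarrow> rep p \<in> fvec.span (rep ` X)"
    if p: "p \<in> PG_points r" for p
  proof (cases "rep p \<in> fvec.span (rep ` X)")
    case True
    then have "rk (PG r) (insert p X) = card I"
      using X I B p spanI by (intro rk_PG) auto
    then show ?thesis using True rkX by simp
  next
    case False
    then have "p \<notin> I" using I fvec.span_base[of "rep p" "rep ` X"] by blast
    have "indep (PG r) (insert p I)"
      using False spanI B I X p by (auto simp: indep_PG_iff fvec.independent_insert)
    then have "card (insert p I) \<le> rk (PG r) (insert p X)" using I by (intro card_le_rk) auto
    then show ?thesis using False rkX \<open>p \<notin> I\<close> finI by simp
  qed
  then show ?thesis by (auto simp: cl_def)
qed

lemma span_single_in_cl_PG:
  assumes "v \<noteq> 0" "v \<in> coord_space (Suc r)" "v \<in> fvec.span (rep ` X)" "X \<subseteq> PG_points r"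
  shows "fvec.span {v} \<in> cl (PG r :: 'f::{field,finite} point set_system) X"
proof -
  have p: "fvec.span {v} \<in> PG_points r" using assms by (intro span_single_in_PG_points)
  have "fvec.span {v} \<subseteq> fvec.span (rep ` X)"
    using assms by (intro fvec.span_minimal fvec.subspace_span) auto
  then show ?thesis using rep_in[OF p] p by (auto simp: cl_PG[OF assms(4)])
qed

section \<open>Lines and cones in projective space\<close>

lemma cl_PG_single:
  assumes "p \<in> PG_points r"
  shows "cl (PG r :: 'f::{field,finite} point set_system) {p} = {p}"
proof -
  have "x = p" if "x \<in> PG_points r" "rep x \<in> fvec.span {rep p}" for x
    using span_single_eq[OF rep(1)[OF that(1)] that(2)] rep(2)[OF that(1)] rep(2)[OF assms] by simp
  moreover have "rep p \<in> fvec.span {rep p}" by (simp add: fvec.span_base)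
  ultimately show ?thesis using assms by (subst cl_PG) auto
qed

lemma rep_notin_span_single:
  assumes "p \<in> PG_points r" "p' \<in> PG_points r" "p \<noteq> p'"
  shows "rep p \<notin> fvec.span {rep (p' :: 'f::{field,finite} point)}"
  using cl_PG_single[OF assms(2)] cl_PG[of "{p'}" r] assms by auto

text \<open>Besides \<open>a\<close>, the line consists of the points spanned by
  \<open>rep e\<close> plus a multiple of \<open>rep a\<close>, one for each scalar.\<close>

lemma card_line_PG:
  fixes a e :: "'f::{field,finite} point"
  assumes a: "a \<in> PG_points r" and e: "e \<in> PG_points r" and "a \<noteq> e"
  shows "card (cl (PG r) {a, e}) = Suc CARD('f)"
proof -
  define f where "f c = rep e + fscale c (rep a)" for c
  have ne: "rep e \<notin> fvec.span {rep a}" using assms by (intro rep_notin_span_single) auto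
  have f_notin: "f c \<notin> fvec.span {rep a}" for c
  proof
    assume "f c \<in> fvec.span {rep a}"
    then have "f c - fscale c (rep a) \<in> fvec.span {rep a}"
      by (intro fvec.span_diff fvec.span_scale fvec.span_base[of "rep a"]) auto
    then show False using ne by (simp add: f_def)
  qed
  then have f0: "f c \<noteq> 0" for c using fvec.span_zero by metis
  have f_coord: "f c \<in> coord_space (Suc r)" for c
    unfolding f_def using rep_in_coord_space[OF a] rep_in_coord_space[OF e] subspace_coord_space
    by (intro fvec.subspace_add fvec.subspace_scale)
  have f_span: "f c \<in> fvec.span (rep ` {a, e})" for c
    unfolding f_def by (intro fvec.span_add fvec.span_scale fvec.span_base) auto
  have "cl (PG r) {a, e} = insert a (range (\<lambda>c. fvec.span {f c}))"
  proof (intro equalityI subsetI)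
    fix p assume "p \<in> cl (PG r) {a, e}"
    then have p: "p \<in> PG_points r" "rep p \<in> fvec.span (insert (rep a) {rep e})"
      using a e by (auto simp: cl_PG)
    then obtain k u where ku: "rep p - fscale k (rep a) = fscale u (rep e)"
      by (auto simp: fvec.span_insert fvec.span_singleton)
    show "p \<in> insert a (range (\<lambda>c. fvec.span {f c}))"
    proof (cases "u = 0")
      case True
      then have "rep p = fscale k (rep a)" using ku by simp
      then have "rep p \<in> fvec.span {rep a}" by (auto simp: fvec.span_singleton)
      then show ?thesis using rep_notin_span_single[OF p(1) a] by auto
    next
      case False
      have "rep p = fscale u (rep e) + fscale k (rep a)" using ku by (simp add: algebra_simps)
      \<comment> \<open>Scaling the coefficient of \<open>rep e\<close> to 1 leaves the parameter
        \<open>k / u\<close>.\<close>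
      then have "rep p = fscale u (f (k / u))"
        using False by (simp add: f_def fvec.scale_right_distrib)
      then have "rep p \<in> fvec.span {f (k / u)}" by (auto simp: fvec.span_singleton)
      then have "fvec.span {rep p} = fvec.span {f (k / u)}"
        using rep(1)[OF p(1)] by (intro span_single_eq)
      then show ?thesis using rep(2)[OF p(1)] by auto
    qed
  next
    fix p assume "p \<in> insert a (range (\<lambda>c. fvec.span {f c}))"
    then show "p \<in> cl (PG r) {a, e}"
    proof
      assume "p = a"
      then show ?thesis using a e by (auto simp: cl_PG fvec.span_base)
    next
      assume "p \<in> range (\<lambda>c. fvec.span {f c})"
      then show ?thesis using span_single_in_cl_PG[OF f0 f_coord f_span] a e by auto
    qed
  qed
  moreover have "a \<notin> range (\<lambda>c. fvec.span {f c})"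
    using f_notin fvec.span_base rep(2)[OF a] by auto
  moreover have "inj (\<lambda>c. fvec.span {f c})"
  proof (rule injI)
    fix c d assume "fvec.span {f c} = fvec.span {f d}"
    then have "f c \<in> fvec.span {f d}" using fvec.span_base[of "f c" "{f c}"] by auto
    then obtain t where t: "f c = fscale t (f d)" by (auto simp: fvec.span_singleton)
    then have eq: "fscale (1 - t) (rep e) = fscale (t * d - c) (rep a)"
      by (auto simp: f_def fscale_def fun_eq_iff algebra_simps)
    have "t = 1"
    proof (rule ccontr)
      assume "t \<noteq> 1"
      then have "rep e = fscale (inverse (1 - t)) (fscale (1 - t) (rep e))" by simp
      also have "\<dots> \<in> fvec.span {rep a}"
        unfolding eq by (intro fvec.span_scale fvec.span_base) simp
      finally show False using ne by simp
    qed
    then show "c = d" using eq rep(1)[OF a] by simp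
  qed
  ultimately show ?thesis by (simp add: card_image)
qed

text \<open>A nonempty base ensures that the union of lines contains \<open>a\<close>. For
  \<open>line_meets\<close> the meeting point is computed from coordinates.\<close>

lemma cone_matroid_restriction_PG:
  fixes E :: "'f::{field,finite} point set"
  assumes E: "E \<subseteq> PG_points r" "E \<noteq> {}" and a: "a \<in> PG_points r" "a \<notin> cl (PG r) E"
  shows "cone_matroid (restriction (PG r) (\<Union>p\<in>E. cl (PG r) {a, p})) E a CARD('f)"
proof -
  interpret P: matroid "PG r :: 'f point set_system" by (rule matroid_PG)
  define E' where "E' = (\<Union>p\<in>E. cl (PG r) {a, p})"
  have line: "cl (PG r) {a, p} \<subseteq> E'" "a \<in> E'" "p \<in> E'" if "p \<in> E" for p
    using that E a P.cl_extensive[of "{a, p}"] by (auto simp: E'_def)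
  have aE': "a \<in> E'" and EE': "E \<subseteq> E'" using line E by auto
  have E'g: "E' \<subseteq> PG_points r" using P.cl_subset_ground by (auto simp: E'_def)
  have ground: "ground (restriction (PG r) E') = E'" using E'g by (auto simp: restriction_def)
  have clE': "cl (restriction (PG r) E') X = cl (PG r) X \<inter> E'" if "X \<subseteq> E'" for X
    using that by (rule cl_restriction)
  have aE: "a \<notin> E" using a P.cl_extensive[of E] E by auto
  interpret matroid "restriction (PG r) E'" by (rule matroid_restriction[OF matroid_PG])
  show ?thesis
    unfolding E'_def[symmetric]
  proof
    show "a \<in> ground (restriction (PG r) E')" "E \<subseteq> ground (restriction (PG r) E')"
      using aE' EE' ground by auto
    show "a \<notin> cl (restriction (PG r) E') E" using a clE'[OF EE'] by auto
  next
    fix x assume "x \<in> ground (restriction (PG r) E')"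
    then have x: "x \<in> E'" using ground by auto
    then show "cl (restriction (PG r) E') {x} = {x}"
      using cl_PG_single[of x r] E'g clE'[of "{x}"] by auto
    show "\<exists>e\<in>E. x \<in> cl (restriction (PG r) E') {a, e}"
    proof -
      obtain p where "p \<in> E" "x \<in> cl (PG r) {a, p}" using x by (auto simp: E'_def)
      then show ?thesis using clE'[of "{a, p}"] line[of p] x by auto
    qed
  next
    fix e assume e: "e \<in> E"
    have line_e: "cl (restriction (PG r) E') {a, e} = cl (PG r) {a, e}"
      using clE'[of "{a, e}"] line[OF e] by auto
    then show "card (cl (restriction (PG r) E') {a, e}) = Suc CARD('f)"
      using e E a aE by (auto intro!: card_line_PG)
    fix F assume F: "F \<subseteq> ground (restriction (PG r) E')"
      and "e \<in> cl (restriction (PG r) E') (insert a F)"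
    then have F': "F \<subseteq> E'" and eF: "e \<in> cl (PG r) (insert a F)"
      using clE'[of "insert a F"] ground aE' by auto
    have pts: "F \<subseteq> PG_points r" "e \<in> PG_points r" using F' E'g e E by auto
    have "rep e \<in> fvec.span (insert (rep a) (rep ` F))" using eF pts a by (auto simp: cl_PG)
    then obtain k where k: "rep e - fscale k (rep a) \<in> fvec.span (rep ` F)"
      by (auto simp: fvec.span_insert)
    \<comment> \<open>Removing a multiple of \<open>rep a\<close> from \<open>rep e\<close> leaves a
      vector in the span of \<open>F\<close>; it spans the point where the line meets the closure of
      \<open>F\<close>.\<close>
    define v where "v = rep e - fscale k (rep a)"
    have "v \<noteq> 0"
    proof
      assume "v = 0"
      then have "rep e = fscale k (rep a)" by (simp add: v_def)
      then have "rep e \<in> fvec.span {rep a}" by (auto simp: fvec.span_singleton)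
      then show False using rep_notin_span_single[OF pts(2) a(1)] e aE by auto
    qed
    moreover have "v \<in> coord_space (Suc r)"
      unfolding v_def using rep_in_coord_space[OF a(1)] rep_in_coord_space[OF pts(2)]
      by (intro fvec.subspace_diff fvec.subspace_scale subspace_coord_space)
    moreover have "v \<in> fvec.span (rep ` {a, e})"
      unfolding v_def by (intro fvec.span_diff fvec.span_scale fvec.span_base) auto
    ultimately have "fvec.span {v} \<in> cl (PG r) F" "fvec.span {v} \<in> cl (PG r) {a, e}"
      using k pts a by (auto intro!: span_single_in_cl_PG simp: v_def)
    \<comment> \<open>The whole line to \<open>e\<close> lies in \<open>E'\<close>, so the meeting
      point survives the restriction.\<close>
    then show "cl (restriction (PG r) E') F \<inter> cl (restriction (PG r) E') {a, e} \<noteq> {}"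
      using clE'[OF F'] line_e line[OF e] by auto
  qed
qed

section \<open>The invariants of a q-cone\<close>

definition cone_catenary :: "nat \<Rightarrow> nat list multiset \<Rightarrow> nat list multiset" where
  "cone_catenary q A = (if A = {#[0]#} then {#[0]#} else (\<Sum>b\<in>#A. cone_comps q b))"

text \<open>The empty matroid is exceptional: its cone, a union over the empty set, lacks the apex.\<close>

lemma catenary_mset_q_cone:
  fixes M :: "'a set_system" and M' :: "'f::{field,finite} point set_system"
  assumes M: "matroid M" and cone: "is_q_cone M' M"
  shows "matroid M'" "catenary_mset M' = cone_catenary CARD('f) (catenary_mset M)"
proof -
  define r where "r = rk M (ground M)"
  interpret M: matroid M by fact
  obtain E a where E: "E \<subseteq> PG_points r" and iso: "isomorphic (restriction (PG r) E) M"
    and a: "a \<in> PG_points r" "a \<notin> cl (PG r) E"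
    and M': "M' = restriction (PG r) (\<Union>p\<in>E. cl (PG r) {a, p})"
    using cone by (auto simp: is_q_cone_def Let_def r_def)
  show matM': "matroid M'" unfolding M' by (rule matroid_restriction[OF matroid_PG])
  have gE: "ground (restriction (PG r) E) = E" using E by (auto simp: restriction_def)
  obtain f where f: "bij_betw f E (ground M)"
    and ind: "\<And>X. X \<subseteq> E \<Longrightarrow> indep (restriction (PG r) E) X \<longleftrightarrow> indep M (f ` X)"
    using iso by (auto simp: isomorphic_def gE)
  show "catenary_mset M' = cone_catenary CARD('f) (catenary_mset M)"
  proof (cases "E = {}")
    case True
    \<comment> \<open>The empty matroid has one flag, of composition \<open>[0]\<close>;
      \<open>cone_comps\<close> would turn this into \<open>[0, 1]\<close>, a lone apex.\<close>
    have "catenary_mset M' = {#[0]#}"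
      using matroid.rk_empty[OF matM'] by (simp add: catenary_mset_def M' True restriction_def)
    moreover have "ground M = {}" using f True by (simp add: bij_betw_def)
    ultimately show ?thesis by (simp add: cone_catenary_def catenary_mset_def)
  next
    case False
    interpret C: cone_matroid M' E a "CARD('f)"
      unfolding M' using E False a by (rule cone_matroid_restriction_PG)
    have EM': "E \<subseteq> (\<Union>p\<in>E. cl (PG r) {a, p})" using C.base by (auto simp: M' restriction_def)
    have rk: "rk M (f ` X) = rk M' X" if "X \<subseteq> E" for X
    proof -
      have "rk M (f ` X) = rk (restriction (PG r) E) X"
        using f ind that by (intro rk_isomorphism) (auto simp: gE)
      also have "\<dots> = rk M' X" unfolding M' using that EM' by (simp add: rk_restriction)
      finally show ?thesis .
    qed
    have fE: "f ` E = ground M" using f by (simp add: bij_betw_def)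
    \<comment> \<open>\<open>E\<close> is a flat of the cone, so the flags of \<open>M\<close>
      correspond to the chains of flats of \<open>M'\<close> that end in \<open>E\<close>.\<close>
    have "catenary_mset M = flag_comps M' (rk M (ground M)) E"
      unfolding catenary_mset_def
      using flag_comps_bij[OF matM' M C.flat_base M.is_flat_ground f rk] by simp
    also have "rk M (ground M) = rk M' E" using rk[of E] fE by simp
    finally have "catenary_mset M' = (\<Sum>b\<in>#catenary_mset M. cone_comps CARD('f) b)"
      using C.catenary_mset_cone by simp
    moreover have "catenary_mset M \<noteq> {#[0]#}"
    proof
      assume "catenary_mset M = {#[0]#}"
      then have "card (ground M) = 0" using M.catenary_mset_props(2)[of "[0]"] by simp
      then show False using M.finite_ground fE False by auto
    qed
    ultimately show ?thesis by (simp add: cone_catenary_def)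
  qed
qed

text \<open>Either alternative gives equality of \<open>catenary_mset\<close>, which
  \<open>cone_catenary\<close> passes on to the cones; there it gives both conclusions.\<close>

lemma q_cone_invariants_cong:
  fixes M' N' :: "'f::{field,finite} point set_system"
  assumes mat: "matroid M" "matroid N" and cones: "is_q_cone M' M" "is_q_cone N' N"
    and eq: "catenary_data M = catenary_data N \<or>
      (G_invariant M :: nat list \<Rightarrow>\<^sub>0 'k::field_char_0) = G_invariant N"
  shows "catenary_data M' = catenary_data N' \<and>
    (G_invariant M' :: nat list \<Rightarrow>\<^sub>0 'k) = G_invariant N'"
proof -
  note M' = catenary_mset_q_cone[OF mat(1) cones(1)]
  note N' = catenary_mset_q_cone[OF mat(2) cones(2)]
  have "catenary_mset M = catenary_mset N"
    using eq catenary_data_eq_iff[OF mat] G_invariant_eq_iff[OF mat, where 'k = 'k] by blast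
  then have "catenary_mset M' = catenary_mset N'" using M'(2) N'(2) by simp
  then show ?thesis
    using catenary_data_eq_iff[OF M'(1) N'(1)] G_invariant_eq_iff[OF M'(1) N'(1), where 'k = 'k]
    by blast
qed

text \<open>A value of \<open>g\<close> is sent to \<open>h\<close> of some chosen \<open>y'\<close>
  related to it. The choice may differ from the given \<open>y\<close>, but by assumption
  \<open>h\<close> does not see the difference.\<close>

lemma ex_factor_through:
  assumes "\<And>x y x' y'. Q x y \<Longrightarrow> Q x' y' \<Longrightarrow> g x = g x' \<Longrightarrow> h y = h y'"
  shows "\<exists>\<Phi>. \<forall>x y. Q x y \<longrightarrow> h y = \<Phi> (g x)"
proof (intro exI allI impI)
  fix x y assume Q: "Q x y"
  then have "\<exists>y' x'. Q x' y' \<and> g x' = g x" by blast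
  from someI_ex[OF this] obtain x' where "Q x' (SOME y'. \<exists>x'. Q x' y' \<and> g x' = g x)" "g x' = g x"
    by blast
  then show "h y = (\<lambda>z. h (SOME y'. \<exists>x'. Q x' y' \<and> g x' = z)) (g x)"
    using assms[OF Q] by simp
qed

theorem proposition4p14:
  fixes q :: nat
  assumes "primepow q" and "CARD('f::{field,finite}) = q"
  shows
    "(\<exists>\<Phi>. \<forall>(M :: 'a set_system) (M' :: 'f point set_system).
        simple_matroid M \<and> representable TYPE('f) M \<and> is_q_cone M' M \<longrightarrow>
        catenary_data M' = \<Phi> (catenary_data M)) \<and>
     (\<exists>\<Gamma>. \<forall>(M :: 'a set_system) (M' :: 'f point set_system).
        simple_matroid M \<and> representable TYPE('f) M \<and> is_q_cone M' M \<longrightarrow>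
        (G_invariant M' :: nat list \<Rightarrow>\<^sub>0 'k::field_char_0) =
          \<Gamma> (G_invariant M :: nat list \<Rightarrow>\<^sub>0 'k)) \<and>
     (\<forall>(M :: 'a set_system) (N :: 'b set_system)
         (M' :: 'f point set_system) (N' :: 'f point set_system).
        simple_matroid M \<and> representable TYPE('f) M \<and>
        simple_matroid N \<and> representable TYPE('f) N \<and>
        (catenary_data M = catenary_data N \<or>
         (G_invariant M :: nat list \<Rightarrow>\<^sub>0 'k) = G_invariant N) \<and>
        is_q_cone M' M \<and> is_q_cone N' N \<longrightarrow>
        catenary_data M' = catenary_data N' \<and>
        (G_invariant M' :: nat list \<Rightarrow>\<^sub>0 'k) = G_invariant N')"
proof -
  have main: "catenary_data M' = catenary_data N' \<and>
      (G_invariant M' :: nat list \<Rightarrow>\<^sub>0 'k) = G_invariant N'"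
    if "simple_matroid M" "simple_matroid N" "is_q_cone M' M" "is_q_cone N' N"
      and "catenary_data M = catenary_data N \<or>
        (G_invariant M :: nat list \<Rightarrow>\<^sub>0 'k) = G_invariant N"
    for M N :: "'a set_system" and M' N' :: "'f point set_system"
    using that by (intro q_cone_invariants_cong[of M N]) (auto simp: simple_matroid_def)
  show ?thesis
  proof (intro conjI)
    \<comment> \<open>By \<open>main\<close>, the invariant of the cone is constant where that of
      the matroid is, so it factors through it.\<close>
    show "\<exists>\<Phi>. \<forall>(M :: 'a set_system) (M' :: 'f point set_system).
        simple_matroid M \<and> representable TYPE('f) M \<and> is_q_cone M' M \<longrightarrow>
        catenary_data M' = \<Phi> (catenary_data M)"
      by (rule ex_factor_through) (use main in blast)
    show "\<exists>\<Gamma>. \<forall>(M :: 'a set_system) (M' :: 'f point set_system).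
        simple_matroid M \<and> representable TYPE('f) M \<and> is_q_cone M' M \<longrightarrow>
        (G_invariant M' :: nat list \<Rightarrow>\<^sub>0 'k) = \<Gamma> (G_invariant M :: nat list \<Rightarrow>\<^sub>0 'k)"
      by (rule ex_factor_through) (use main in blast)
  qed (use q_cone_invariants_cong[where 'k = 'k] in \<open>unfold simple_matroid_def, blast\<close>)
qed

end
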